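(* It is provable in $\mathbf{ZF}$ that the following are equivalent: (i) $\mathbf{IQDI}$; (ii) for every infinite set $X$, the space $\mathbf{X}_{cof}$ is not a $P$-space; (iii) for every infinite set $X$ and any element $\infty\notin X$, the space $\mathbf{X}(\infty)$ is not a $P$-space.
   Context: The base theory is $\mathbf{ZF}$ (no Axiom of Choice). A set is Dedekind-infinite if it is equipotent to a proper subset of itself. A set $X$ is quasi Dedekind-infinite if the set $[X]^{<\omega}$ of its finite subsets is Dedekind-infinite. $\mathbf{IQDI}$: every infinite set is quasi Dedekind-infinite. A topological space is a $P$-space if all its $G_\delta$-sets are open. $\mathbf{X}_{cof}$ is the set $X$ with the cofinite topology $\{\emptyset\}\cup\{X\setminus F:F\in[X]^{<\omega}\}$. For an infinite set $X$ and $\infty\notin X$, $\mathbf{X}(\infty)$ is the set $X\cup\{\infty\}$ with topology $\mathcal{P}(X)\cup\{(X\cup\{\infty\})\setminus F:F\in[X]^{<\omega}\}$. *)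

theory Defs
  imports Main
begin

text \<open>
  HOL has the axiom of choice, so the choice-free content of "provable in ZF" is lost
  if sets are modelled by HOL sets. ZF is therefore formalised as a first-order theory, with its
  language and a proof calculus as HOL objects.
\<close>

section \<open>First-order logic with equality over one binary relation symbol\<close>

text \<open>Variables are de Bruijn indices; the only terms are variables.\<close>

datatype fm =
    Bot
  | Mem nat nat
  | Eq nat nat
  | Imp fm fm
  | Forall fm

text \<open>\<open>ren f\<close> replaces each free variable \<open>i\<close> by \<open>f i\<close>, avoiding capture.\<close>

primrec ren :: "(nat \<Rightarrow> nat) \<Rightarrow> fm \<Rightarrow> fm" where
  "ren f Bot = Bot"
| "ren f (Mem i j) = Mem (f i) (f j)"
| "ren f (Eq i j) = Eq (f i) (f j)"
| "ren f (Imp p q) = Imp (ren f p) (ren f q)"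
| "ren f (Forall p) = Forall (ren (case_nat 0 (\<lambda>i. Suc (f i))) p)"

definition inst :: "nat \<Rightarrow> fm \<Rightarrow> fm" where
  "inst t p = ren (case_nat t (\<lambda>i. i)) p"

text \<open>All free variables of the formula are below the bound.\<close>

primrec fv_below :: "nat \<Rightarrow> fm \<Rightarrow> bool" where
  "fv_below n Bot = True"
| "fv_below n (Mem i j) = (i < n \<and> j < n)"
| "fv_below n (Eq i j) = (i < n \<and> j < n)"
| "fv_below n (Imp p q) = (fv_below n p \<and> fv_below n q)"
| "fv_below n (Forall p) = fv_below (Suc n) p"

text \<open>Classical natural deduction. In \<open>AllI\<close> the assumptions are shifted, so that the variable
  \<open>0\<close>, which gets bound, is not free in them.\<close>

inductive provable :: "fm set \<Rightarrow> fm \<Rightarrow> bool" (infix "\<turnstile>" 50) where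
  Assm: "p \<in> \<Gamma> \<Longrightarrow> \<Gamma> \<turnstile> p"
| ImpI: "insert p \<Gamma> \<turnstile> q \<Longrightarrow> \<Gamma> \<turnstile> Imp p q"
| ImpE: "\<Gamma> \<turnstile> Imp p q \<Longrightarrow> \<Gamma> \<turnstile> p \<Longrightarrow> \<Gamma> \<turnstile> q"
| Contr: "insert (Imp p Bot) \<Gamma> \<turnstile> Bot \<Longrightarrow> \<Gamma> \<turnstile> p"
| AllI: "ren Suc ` \<Gamma> \<turnstile> p \<Longrightarrow> \<Gamma> \<turnstile> Forall p"
| AllE: "\<Gamma> \<turnstile> Forall p \<Longrightarrow> \<Gamma> \<turnstile> inst t p"
| EqRefl: "\<Gamma> \<turnstile> Eq t t"
| EqSubst: "\<Gamma> \<turnstile> Eq s t \<Longrightarrow> \<Gamma> \<turnstile> inst s p \<Longrightarrow> \<Gamma> \<turnstile> inst t p"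

section \<open>Readable notation for formulas\<close>

text \<open>
  To write formulas with HOL-bound names, a formula is given as a function of the number \<open>d\<close> of
  enclosing quantifiers, and a variable is named by its level, the number of quantifiers
  enclosing its binder. At depth \<open>d\<close> the level \<open>x < d\<close> is the de Bruijn index \<open>d - Suc x\<close>.
  A sentence \<open>P\<close> in this notation denotes the formula \<open>P 0\<close>.
\<close>

type_synonym lfm = "nat \<Rightarrow> fm"

definition lmem :: "nat \<Rightarrow> nat \<Rightarrow> lfm" (infix "\<^bold>\<in>" 70) where
  "(x \<^bold>\<in> y) = (\<lambda>d. Mem (d - Suc x) (d - Suc y))"

definition leql :: "nat \<Rightarrow> nat \<Rightarrow> lfm" (infix "\<^bold>=" 70) where
  "(x \<^bold>= y) = (\<lambda>d. Eq (d - Suc x) (d - Suc y))"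

definition limp :: "lfm \<Rightarrow> lfm \<Rightarrow> lfm" (infixr "\<^bold>\<longrightarrow>" 55) where
  "(P \<^bold>\<longrightarrow> Q) = (\<lambda>d. Imp (P d) (Q d))"

definition lneg :: "lfm \<Rightarrow> lfm" ("\<^bold>\<not> _" [68] 68) where
  "(\<^bold>\<not> P) = (P \<^bold>\<longrightarrow> (\<lambda>d. Bot))"

definition lconj :: "lfm \<Rightarrow> lfm \<Rightarrow> lfm" (infixr "\<^bold>\<and>" 65) where
  "(P \<^bold>\<and> Q) = (\<^bold>\<not> (P \<^bold>\<longrightarrow> \<^bold>\<not> Q))"

definition ldisj :: "lfm \<Rightarrow> lfm \<Rightarrow> lfm" (infixr "\<^bold>\<or>" 60) where
  "(P \<^bold>\<or> Q) = (\<^bold>\<not> P \<^bold>\<longrightarrow> Q)"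

definition liff :: "lfm \<Rightarrow> lfm \<Rightarrow> lfm" (infix "\<^bold>\<longleftrightarrow>" 53) where
  "(P \<^bold>\<longleftrightarrow> Q) = ((P \<^bold>\<longrightarrow> Q) \<^bold>\<and> (Q \<^bold>\<longrightarrow> P))"

definition lforall :: "(nat \<Rightarrow> lfm) \<Rightarrow> lfm" (binder "\<^bold>\<forall>" 50) where
  "(\<^bold>\<forall>x. P x) = (\<lambda>d. Forall (P d (Suc d)))"

definition lexists :: "(nat \<Rightarrow> lfm) \<Rightarrow> lfm" (binder "\<^bold>\<exists>" 50) where
  "(\<^bold>\<exists>x. P x) = (\<^bold>\<not> (\<^bold>\<forall>x. \<^bold>\<not> P x))"

text \<open>\<open>app p [x\<^sub>0, \<dots>, x\<^sub>k]\<close> is \<open>p\<close> with the free variable (index) \<open>i\<close> of \<open>p\<close> replaced by the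
  variable with level \<open>x\<^sub>i\<close>; it is used for \<open>fv_below (Suc k) p\<close>.\<close>

definition app :: "fm \<Rightarrow> nat list \<Rightarrow> lfm" where
  "app p xs = (\<lambda>d. ren (\<lambda>i. d - Suc (xs ! i)) p)"

text \<open>Universal closure over \<open>n\<close> parameters, which have levels \<open>0, \<dots>, n - 1\<close>.\<close>

definition closure :: "nat \<Rightarrow> lfm \<Rightarrow> fm" where
  "closure n P = (Forall ^^ n) (P n)"

section \<open>Set-theoretic vocabulary\<close>

definition is_empty :: "nat \<Rightarrow> lfm" where
  "is_empty x = (\<^bold>\<forall>z. \<^bold>\<not> z \<^bold>\<in> x)"

definition lsub :: "nat \<Rightarrow> nat \<Rightarrow> lfm" (infix "\<^bold>\<subseteq>" 70) where
  "(x \<^bold>\<subseteq> y) = (\<^bold>\<forall>z. z \<^bold>\<in> x \<^bold>\<longrightarrow> z \<^bold>\<in> y)"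

text \<open>\<open>z = {x, y}\<close>\<close>

definition is_upair :: "nat \<Rightarrow> nat \<Rightarrow> nat \<Rightarrow> lfm" where
  "is_upair z x y = (\<^bold>\<forall>w. w \<^bold>\<in> z \<^bold>\<longleftrightarrow> (w \<^bold>= x \<^bold>\<or> w \<^bold>= y))"

text \<open>\<open>p = (x, y) = {{x}, {x, y}}\<close>\<close>

definition is_pair :: "nat \<Rightarrow> nat \<Rightarrow> nat \<Rightarrow> lfm" where
  "is_pair p x y = (\<^bold>\<exists>u. \<^bold>\<exists>v. is_upair u x x \<^bold>\<and> is_upair v x y \<^bold>\<and> is_upair p u v)"

text \<open>\<open>z = x - y\<close>\<close>

definition is_diff :: "nat \<Rightarrow> nat \<Rightarrow> nat \<Rightarrow> lfm" where
  "is_diff z x y = (\<^bold>\<forall>w. w \<^bold>\<in> z \<^bold>\<longleftrightarrow> (w \<^bold>\<in> x \<^bold>\<and> \<^bold>\<not> w \<^bold>\<in> y))"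

text \<open>\<open>z = x \<union> {y}\<close>\<close>

definition is_adjoin :: "nat \<Rightarrow> nat \<Rightarrow> nat \<Rightarrow> lfm" where
  "is_adjoin z x y = (\<^bold>\<forall>w. w \<^bold>\<in> z \<^bold>\<longleftrightarrow> (w \<^bold>\<in> x \<^bold>\<or> w \<^bold>= y))"

definition is_inductive :: "nat \<Rightarrow> lfm" where
  "is_inductive w = ((\<^bold>\<exists>e. is_empty e \<^bold>\<and> e \<^bold>\<in> w) \<^bold>\<and>
     (\<^bold>\<forall>x. x \<^bold>\<in> w \<^bold>\<longrightarrow> (\<^bold>\<exists>y. is_adjoin y x x \<^bold>\<and> y \<^bold>\<in> w)))"

definition is_omega :: "nat \<Rightarrow> lfm" where
  "is_omega w = (is_inductive w \<^bold>\<and> (\<^bold>\<forall>v. is_inductive v \<^bold>\<longrightarrow> w \<^bold>\<subseteq> v))"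

text \<open>\<open>(x, y) \<in> f\<close>\<close>

definition maps :: "nat \<Rightarrow> nat \<Rightarrow> nat \<Rightarrow> lfm" where
  "maps f x y = (\<^bold>\<exists>p. is_pair p x y \<^bold>\<and> p \<^bold>\<in> f)"

text \<open>\<open>f\<close> is a function from \<open>A\<close> to \<open>B\<close>.\<close>

definition is_fun :: "nat \<Rightarrow> nat \<Rightarrow> nat \<Rightarrow> lfm" where
  "is_fun f A B =
     ((\<^bold>\<forall>p. p \<^bold>\<in> f \<^bold>\<longrightarrow> (\<^bold>\<exists>x. \<^bold>\<exists>y. x \<^bold>\<in> A \<^bold>\<and> y \<^bold>\<in> B \<^bold>\<and> is_pair p x y)) \<^bold>\<and>
      (\<^bold>\<forall>x. x \<^bold>\<in> A \<^bold>\<longrightarrow> (\<^bold>\<exists>y. maps f x y)) \<^bold>\<and>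
      (\<^bold>\<forall>x. \<^bold>\<forall>y. \<^bold>\<forall>z. maps f x y \<^bold>\<and> maps f x z \<^bold>\<longrightarrow> y \<^bold>= z))"

definition is_bij :: "nat \<Rightarrow> nat \<Rightarrow> nat \<Rightarrow> lfm" where
  "is_bij f A B =
     (is_fun f A B \<^bold>\<and>
      (\<^bold>\<forall>x. \<^bold>\<forall>y. \<^bold>\<forall>z. maps f x z \<^bold>\<and> maps f y z \<^bold>\<longrightarrow> x \<^bold>= y) \<^bold>\<and>
      (\<^bold>\<forall>y. y \<^bold>\<in> B \<^bold>\<longrightarrow> (\<^bold>\<exists>x. maps f x y)))"

definition equipotent :: "nat \<Rightarrow> nat \<Rightarrow> lfm" where
  "equipotent A B = (\<^bold>\<exists>f. is_bij f A B)"

definition is_finite :: "nat \<Rightarrow> lfm" where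
  "is_finite X = (\<^bold>\<exists>w. \<^bold>\<exists>n. is_omega w \<^bold>\<and> n \<^bold>\<in> w \<^bold>\<and> equipotent X n)"

definition is_infinite :: "nat \<Rightarrow> lfm" where
  "is_infinite X = (\<^bold>\<not> is_finite X)"

section \<open>The axioms of ZF\<close>

definition extensionality :: lfm where
  "extensionality = (\<^bold>\<forall>x. \<^bold>\<forall>y. (\<^bold>\<forall>z. z \<^bold>\<in> x \<^bold>\<longleftrightarrow> z \<^bold>\<in> y) \<^bold>\<longrightarrow> x \<^bold>= y)"

definition foundation :: lfm where
  "foundation = (\<^bold>\<forall>x. \<^bold>\<not> is_empty x \<^bold>\<longrightarrow> (\<^bold>\<exists>y. y \<^bold>\<in> x \<^bold>\<and> \<^bold>\<not> (\<^bold>\<exists>z. z \<^bold>\<in> x \<^bold>\<and> z \<^bold>\<in> y)))"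

definition pairing :: lfm where
  "pairing = (\<^bold>\<forall>x. \<^bold>\<forall>y. \<^bold>\<exists>z. is_upair z x y)"

definition union :: lfm where
  "union = (\<^bold>\<forall>x. \<^bold>\<exists>u. \<^bold>\<forall>z. z \<^bold>\<in> u \<^bold>\<longleftrightarrow> (\<^bold>\<exists>y. y \<^bold>\<in> x \<^bold>\<and> z \<^bold>\<in> y))"

definition powerset :: lfm where
  "powerset = (\<^bold>\<forall>x. \<^bold>\<exists>p. \<^bold>\<forall>z. z \<^bold>\<in> p \<^bold>\<longleftrightarrow> z \<^bold>\<subseteq> x)"

definition infinity :: lfm where
  "infinity = (\<^bold>\<exists>w. is_inductive w)"

text \<open>In the schemas, the free variables \<open>0, \<dots>, n - 1\<close> of \<open>p\<close> are parameters, followed by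
  \<open>x\<close> (separation) or by \<open>x\<close> and \<open>y\<close> (replacement).\<close>

definition separation :: "nat \<Rightarrow> fm \<Rightarrow> lfm" where
  "separation n p = (\<^bold>\<forall>a. \<^bold>\<exists>b. \<^bold>\<forall>x. x \<^bold>\<in> b \<^bold>\<longleftrightarrow> (x \<^bold>\<in> a \<^bold>\<and> app p ([0..<n] @ [x])))"

definition replacement :: "nat \<Rightarrow> fm \<Rightarrow> lfm" where
  "replacement n p =
     (\<^bold>\<forall>a. (\<^bold>\<forall>x. x \<^bold>\<in> a \<^bold>\<longrightarrow> (\<^bold>\<forall>y. \<^bold>\<forall>z.
             app p ([0..<n] @ [x, y]) \<^bold>\<and> app p ([0..<n] @ [x, z]) \<^bold>\<longrightarrow> y \<^bold>= z)) \<^bold>\<longrightarrow>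
          (\<^bold>\<exists>b. \<^bold>\<forall>y. y \<^bold>\<in> b \<^bold>\<longleftrightarrow> (\<^bold>\<exists>x. x \<^bold>\<in> a \<^bold>\<and> app p ([0..<n] @ [x, y]))))"

definition ZF :: "fm set" where
  "ZF = {extensionality 0, foundation 0, pairing 0, union 0, powerset 0, infinity 0}
      \<union> {closure n (separation n p) | n p. fv_below (n + 1) p}
      \<union> {closure n (replacement n p) | n p. fv_below (n + 2) p}"

section \<open>Quasi Dedekind-infinite sets and P-spaces\<close>

definition dedekind_infinite :: "nat \<Rightarrow> lfm" where
  "dedekind_infinite X = (\<^bold>\<exists>Y. Y \<^bold>\<subseteq> X \<^bold>\<and> \<^bold>\<not> Y \<^bold>= X \<^bold>\<and> equipotent X Y)"

text \<open>\<open>S\<close> is the set of finite subsets of \<open>X\<close>.\<close>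

definition is_finite_subsets :: "nat \<Rightarrow> nat \<Rightarrow> lfm" where
  "is_finite_subsets S X = (\<^bold>\<forall>F. F \<^bold>\<in> S \<^bold>\<longleftrightarrow> (F \<^bold>\<subseteq> X \<^bold>\<and> is_finite F))"

definition quasi_dedekind_infinite :: "nat \<Rightarrow> lfm" where
  "quasi_dedekind_infinite X = (\<^bold>\<exists>S. is_finite_subsets S X \<^bold>\<and> dedekind_infinite S)"

definition IQDI :: lfm where
  "IQDI = (\<^bold>\<forall>X. is_infinite X \<^bold>\<longrightarrow> quasi_dedekind_infinite X)"

text \<open>\<open>T\<close> is (the set of open sets of) a topology on \<open>X\<close>.\<close>

definition is_topology :: "nat \<Rightarrow> nat \<Rightarrow> lfm" where
  "is_topology X T =
     ((\<^bold>\<forall>U. U \<^bold>\<in> T \<^bold>\<longrightarrow> U \<^bold>\<subseteq> X) \<^bold>\<and>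
      (\<^bold>\<forall>U. is_empty U \<^bold>\<longrightarrow> U \<^bold>\<in> T) \<^bold>\<and>
      X \<^bold>\<in> T \<^bold>\<and>
      (\<^bold>\<forall>U. \<^bold>\<forall>V. U \<^bold>\<in> T \<^bold>\<and> V \<^bold>\<in> T \<^bold>\<longrightarrow>
         (\<^bold>\<forall>W. (\<^bold>\<forall>z. z \<^bold>\<in> W \<^bold>\<longleftrightarrow> (z \<^bold>\<in> U \<^bold>\<and> z \<^bold>\<in> V)) \<^bold>\<longrightarrow> W \<^bold>\<in> T)) \<^bold>\<and>
      (\<^bold>\<forall>S. S \<^bold>\<subseteq> T \<^bold>\<longrightarrow>
         (\<^bold>\<forall>W. (\<^bold>\<forall>z. z \<^bold>\<in> W \<^bold>\<longleftrightarrow> (\<^bold>\<exists>U. U \<^bold>\<in> S \<^bold>\<and> z \<^bold>\<in> U)) \<^bold>\<longrightarrow> W \<^bold>\<in> T)))"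

text \<open>\<open>G\<close> is the intersection of a sequence of open sets, given as a function from \<open>\<omega>\<close> to \<open>T\<close>.\<close>

definition is_Gdelta :: "nat \<Rightarrow> nat \<Rightarrow> nat \<Rightarrow> lfm" where
  "is_Gdelta G X T =
     (\<^bold>\<exists>w. \<^bold>\<exists>f. is_omega w \<^bold>\<and> is_fun f w T \<^bold>\<and>
        (\<^bold>\<forall>z. z \<^bold>\<in> G \<^bold>\<longleftrightarrow> (z \<^bold>\<in> X \<^bold>\<and> (\<^bold>\<forall>n. \<^bold>\<forall>U. maps f n U \<^bold>\<longrightarrow> z \<^bold>\<in> U))))"

definition is_P_space :: "nat \<Rightarrow> nat \<Rightarrow> lfm" where
  "is_P_space X T = (is_topology X T \<^bold>\<and> (\<^bold>\<forall>G. is_Gdelta G X T \<^bold>\<longrightarrow> G \<^bold>\<in> T))"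

text \<open>\<open>T\<close> is the cofinite topology on \<open>X\<close>.\<close>

definition is_cofinite_topology :: "nat \<Rightarrow> nat \<Rightarrow> lfm" where
  "is_cofinite_topology X T =
     (\<^bold>\<forall>U. U \<^bold>\<in> T \<^bold>\<longleftrightarrow>
        (is_empty U \<^bold>\<or> (\<^bold>\<exists>F. F \<^bold>\<subseteq> X \<^bold>\<and> is_finite F \<^bold>\<and> is_diff U X F)))"

text \<open>\<open>(Y, T)\<close> is the space with underlying set \<open>Y = X \<union> {p}\<close> in which the open sets are the subsets
  of \<open>X\<close> and the complements in \<open>Y\<close> of the finite subsets of \<open>X\<close>; here \<open>p\<close> plays the role of
  \<open>\<infinity>\<close>.\<close>

definition is_infty_space :: "nat \<Rightarrow> nat \<Rightarrow> nat \<Rightarrow> nat \<Rightarrow> lfm" where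
  "is_infty_space Y T X p =
     (is_adjoin Y X p \<^bold>\<and>
      (\<^bold>\<forall>U. U \<^bold>\<in> T \<^bold>\<longleftrightarrow>
         (U \<^bold>\<subseteq> X \<^bold>\<or> (\<^bold>\<exists>F. F \<^bold>\<subseteq> X \<^bold>\<and> is_finite F \<^bold>\<and> is_diff U Y F))))"

definition cofinite_not_P :: lfm where
  "cofinite_not_P =
     (\<^bold>\<forall>X. is_infinite X \<^bold>\<longrightarrow>
        (\<^bold>\<exists>T. is_cofinite_topology X T \<^bold>\<and> \<^bold>\<not> is_P_space X T))"

definition infty_not_P :: lfm where
  "infty_not_P =
     (\<^bold>\<forall>X. is_infinite X \<^bold>\<longrightarrow> (\<^bold>\<forall>p. \<^bold>\<not> p \<^bold>\<in> X \<^bold>\<longrightarrow>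
        (\<^bold>\<exists>Y. \<^bold>\<exists>T. is_infty_space Y T X p \<^bold>\<and> \<^bold>\<not> is_P_space Y T)))"

end

theory Submission
  imports Defs "HOL-Library.Countable" "HOL-Library.Infinite_Set"
begin

text \<open>
  By the completeness theorem it suffices to show the equivalences in every countable model of ZF.
  As the model has its own notion of set, separation and replacement are only available for
  predicates that are first-order definable with parameters over the model, so each predicate and
  operation used comes with a proof of its definability.

  Inside the model: if the set of finite subsets of \<open>X\<close> is Dedekind-infinite, iterating an injection
  that is not surjective gives a sequence of finite sets \<open>F\<^sub>n\<close> with infinitely many values, so that
  their union is infinite. For a point \<open>x\<close> of \<open>X\<close>, the intersection of the cofinite sets
  \<open>X - (F\<^sub>n - {x})\<close> contains \<open>x\<close> and has an infinite complement, so it is not open. A nonempty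
  \<open>G\<^sub>\<delta>\<close>-set of the cofinite topology that is not open becomes one of \<open>X(\<infinity>)\<close> when \<open>\<infinity>\<close> is added.
  Finally, a \<open>G\<^sub>\<delta>\<close>-set of \<open>X(\<infinity>)\<close> that is not open yields finite sets with infinite union; their
  partial unions form a chain of order type \<open>\<omega>\<close>, and shifting this chain by one is an injection of
  the set of finite subsets of \<open>X\<close> into itself that misses \<open>\<emptyset>\<close>.
\<close>

section \<open>Completeness of the proof calculus\<close>

primrec fv :: "fm \<Rightarrow> nat set" where
  "fv Bot = {}"
| "fv (Mem i j) = {i, j}"
| "fv (Eq i j) = {i, j}"
| "fv (Imp p q) = fv p \<union> fv q"
| "fv (Forall p) = Suc -` fv p"

lemma finite_fv: "finite (fv p)"
  by (induction p) (auto intro: finite_vimageI)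

lemma fv_bounded: "\<exists>n. \<forall>i \<in> fv p. i < n"
  using finite_fv[of p] by (meson finite_nat_set_iff_bounded)

lemma fv_below_iff: "fv_below n p \<longleftrightarrow> (\<forall>i \<in> fv p. i < n)"
proof (induction p arbitrary: n)
  case (Forall p)
  have "(\<forall>i \<in> fv p. i < Suc n) \<longleftrightarrow> (\<forall>i. Suc i \<in> fv p \<longrightarrow> i < n)"
    by (metis Suc_less_eq nat.exhaust zero_less_Suc)
  then show ?case using Forall by (simp add: Ball_def)
qed auto

lemma ren_cong: "(\<And>i. i \<in> fv p \<Longrightarrow> f i = g i) \<Longrightarrow> ren f p = ren g p"
proof (induction p arbitrary: f g)
  case (Forall p)
  have "ren (case_nat 0 (\<lambda>i. Suc (f i))) p = ren (case_nat 0 (\<lambda>i. Suc (g i))) p"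
    by (rule Forall.IH) (auto split: nat.split simp: Forall.prems)
  then show ?case by simp
next
  case (Imp p q)
  have "ren f p = ren g p" "ren f q = ren g q"
    by (rule Imp.IH, simp add: Imp.prems)+
  then show ?case by simp
qed simp_all

lemma ren_ren: "ren g (ren f p) = ren (\<lambda>i. g (f i)) p"
proof (induction p arbitrary: f g)
  case (Forall p)
  have "(\<lambda>i. case_nat 0 (\<lambda>i. Suc (g i)) (case_nat 0 (\<lambda>i. Suc (f i)) i))
      = case_nat 0 (\<lambda>i. Suc (g (f i)))"
    by (auto split: nat.split)
  then show ?case by (simp add: Forall)
qed auto

lemma ren_id: "ren (\<lambda>i. i) p = p"
proof (induction p)
  case (Forall p)
  have "case_nat 0 Suc = (\<lambda>i. i)"
    by (auto split: nat.split)
  then show ?case by (simp add: Forall)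
qed auto

lemma fv_ren: "fv (ren f p) = f ` fv p"
proof (induction p arbitrary: f)
  case (Forall p)
  have "Suc -` case_nat 0 (\<lambda>i. Suc (f i)) ` A = f ` Suc -` A" for A
    by (force simp: image_iff split: nat.splits)
  then show ?case by (simp add: Forall)
qed auto

text \<open>Lets a renaming pass through the instances occurring in \<open>AllE\<close> and
  \<open>EqSubst\<close>; under the binder it has to fix index 0.\<close>

lemma ren_inst: "ren f (inst t p) = inst (f t) (ren (case_nat 0 (\<lambda>i. Suc (f i))) p)"
  unfolding inst_def ren_ren by (rule ren_cong) (auto split: nat.split)

lemma ren_lift: "ren Suc ` ren f ` \<Gamma> = ren (case_nat 0 (\<lambda>i. Suc (f i))) ` ren Suc ` \<Gamma>"
  by (simp add: image_image ren_ren)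

section \<open>Structural properties of derivations\<close>

lemma weaken: "\<Gamma> \<turnstile> p \<Longrightarrow> \<Gamma> \<subseteq> \<Delta> \<Longrightarrow> \<Delta> \<turnstile> p"
proof (induction arbitrary: \<Delta> rule: provable.induct)
  case (ImpI p \<Gamma> q)
  then show ?case by (meson insert_mono provable.ImpI)
next
  case (Contr p \<Gamma>)
  then show ?case by (meson insert_mono provable.Contr)
next
  case (AllI \<Gamma> p)
  then show ?case by (meson image_mono provable.AllI)
next
  case (EqSubst \<Gamma> s t p)
  then show ?case by (meson provable.EqSubst)
next
  case (ImpE \<Gamma> p q)
  then show ?case by (meson provable.ImpE)
qed (auto intro: provable.intros)

lemma provable_ren: "\<Gamma> \<turnstile> p \<Longrightarrow> ren f ` \<Gamma> \<turnstile> ren f p"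
proof (induction arbitrary: f rule: provable.induct)
  case (AllI \<Gamma> p)
  then show ?case using ren_lift by (auto intro!: provable.AllI)
next
  case (AllE \<Gamma> p t)
  then show ?case unfolding ren_inst by (auto intro: provable.AllE)
next
  case (EqSubst \<Gamma> s t p)
  then show ?case unfolding ren_inst by (auto intro: provable.EqSubst)
qed (auto intro: provable.intros)

text \<open>A derivation is a finite tree. The finite sets of the premises are united, a discharged
  formula is removed again, and for \<open>AllI\<close> a finite subset of the shifted assumptions
  is pulled back along the shift.\<close>

lemma finite_support: "\<Gamma> \<turnstile> p \<Longrightarrow> \<exists>\<Delta> \<subseteq> \<Gamma>. finite \<Delta> \<and> \<Delta> \<turnstile> p"
proof (induction rule: provable.induct)
  case (Assm p \<Gamma>)
  then show ?case by (intro exI[of _ "{p}"]) (auto intro: provable.Assm)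
next
  case (ImpI p \<Gamma> q)
  then obtain \<Delta> where "\<Delta> \<subseteq> insert p \<Gamma>" "finite \<Delta>" "\<Delta> \<turnstile> q" by blast
  then show ?case
    by (intro exI[of _ "\<Delta> - {p}"]) (auto intro!: provable.ImpI elim: weaken)
next
  case (ImpE \<Gamma> p q)
  then obtain \<Delta> \<Delta>' where "\<Delta> \<subseteq> \<Gamma>" "finite \<Delta>" "\<Delta> \<turnstile> Imp p q" "\<Delta>' \<subseteq> \<Gamma>" "finite \<Delta>'" "\<Delta>' \<turnstile> p" by blast
  then show ?case
    by (intro exI[of _ "\<Delta> \<union> \<Delta>'"]) (auto intro!: provable.ImpE[of _ p q] elim: weaken)
next
  case (Contr p \<Gamma>)
  then obtain \<Delta> where "\<Delta> \<subseteq> insert (Imp p Bot) \<Gamma>" "finite \<Delta>" "\<Delta> \<turnstile> Bot" by blast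
  then show ?case
    by (intro exI[of _ "\<Delta> - {Imp p Bot}"]) (auto intro!: provable.Contr[of p] elim: weaken)
next
  case (AllI \<Gamma> p)
  then obtain \<Delta> where "\<Delta> \<subseteq> ren Suc ` \<Gamma>" "finite \<Delta>" "\<Delta> \<turnstile> p" by blast
  then show ?case
    by (metis finite_subset_image provable.AllI)
next
  case (EqSubst \<Gamma> s t p)
  then obtain \<Delta> \<Delta>' where "\<Delta> \<subseteq> \<Gamma>" "finite \<Delta>" "\<Delta> \<turnstile> Eq s t" "\<Delta>' \<subseteq> \<Gamma>" "finite \<Delta>'" "\<Delta>' \<turnstile> inst s p"
    by blast
  then show ?case
    by (intro exI[of _ "\<Delta> \<union> \<Delta>'"]) (auto intro!: provable.EqSubst[of _ s t p] elim: weaken)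
qed (auto intro: provable.intros)

lemma cut: "\<Gamma> \<turnstile> p \<Longrightarrow> insert p \<Gamma> \<turnstile> q \<Longrightarrow> \<Gamma> \<turnstile> q"
  by (meson provable.ImpE provable.ImpI)

lemma provable_Bot: "\<Gamma> \<turnstile> Bot \<Longrightarrow> \<Gamma> \<turnstile> p"
  by (meson provable.Contr subset_insertI weaken)

text \<open>\<open>AllI\<close> generalises over index 0 with all assumptions shifted. Renaming the
  fresh \<open>t\<close> to 0 and every other \<open>i\<close> to \<open>Suc i\<close> brings the
  derivation into this form, as on formulas without \<open>t\<close> this renaming is the
  shift.\<close>

lemma generalize_fresh:
  assumes "\<Gamma> \<turnstile> inst t q" and "\<And>p. p \<in> \<Gamma> \<Longrightarrow> t \<notin> fv p" and "t \<notin> fv (Forall q)"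
  shows "\<Gamma> \<turnstile> Forall q"
proof (rule provable.AllI)
  define f where "f = (\<lambda>i. if i = t then 0 else Suc i)"
  have 1: "ren f ` \<Gamma> = ren Suc ` \<Gamma>"
    by (rule image_cong[OF refl], rule ren_cong) (use assms(2) in \<open>auto simp: f_def\<close>)
  have "ren f (inst t q) = ren (\<lambda>i. i) q"
    unfolding inst_def ren_ren
    by (rule ren_cong) (use assms(3) in \<open>auto simp: f_def split: nat.split\<close>)
  then show "ren Suc ` \<Gamma> \<turnstile> q"
    using provable_ren[OF assms(1), of f] 1 ren_id by simp
qed

section \<open>Henkin construction of a maximal consistent set\<close>

instance fm :: countable
  by countable_datatype

abbreviation consistent :: "fm set \<Rightarrow> bool" where
  "consistent \<Gamma> \<equiv> \<not> \<Gamma> \<turnstile> Bot"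

text \<open>A negated universal formula gets a counterexample, named by a variable fresh for
  \<open>\<Gamma>\<close>. The choice is meaningful only while a fresh variable exists, which
  \<open>henkin_consistent\<close> ensures.\<close>

definition witness :: "fm set \<Rightarrow> fm \<Rightarrow> fm set" where
  "witness \<Gamma> p = (case p of Imp (Forall q) Bot \<Rightarrow>
      {Imp (inst (SOME t. \<forall>r \<in> \<Gamma>. t \<notin> fv r) q) Bot} | _ \<Rightarrow> {})"

lemma witness_cases:
  "witness \<Gamma> p = {} \<or> (\<exists>q t. p = Imp (Forall q) Bot \<and> witness \<Gamma> p = {Imp (inst t q) Bot})"
  by (auto simp: witness_def split: fm.splits)

text \<open>Maximality and witnesses are obtained in one pass: stage \<open>n\<close> decides the
  formula with code \<open>n\<close> and at once adds its witness, so that the union of all stages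
  has both properties.\<close>

primrec henkin :: "fm set \<Rightarrow> nat \<Rightarrow> fm set" where
  "henkin \<Gamma> 0 = \<Gamma>"
| "henkin \<Gamma> (Suc n) = (let \<Delta> = insert (from_nat n) (henkin \<Gamma> n) in
     if consistent \<Delta> then \<Delta> \<union> witness \<Delta> (from_nat n) else henkin \<Gamma> n)"

text \<open>The invariant of infinitely many fresh variables survives because a stage adds at most
  two formulas, each with finitely many free variables.\<close>

lemma henkin_consistent:
  assumes "consistent \<Gamma>" and "infinite {t. \<forall>p \<in> \<Gamma>. t \<notin> fv p}"
  shows "consistent (henkin \<Gamma> n) \<and> infinite {t. \<forall>p \<in> henkin \<Gamma> n. t \<notin> fv p}"
proof (induction n)
  case 0
  then show ?case using assms by simp
next
  case (Suc n)
  have fresh: "infinite {t. \<forall>p \<in> insert q \<Theta>. t \<notin> fv p}"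
    if "infinite {t. \<forall>p \<in> \<Theta>. t \<notin> fv p}" for q \<Theta>
  proof -
    have "{t. \<forall>p \<in> insert q \<Theta>. t \<notin> fv p} = {t. \<forall>p \<in> \<Theta>. t \<notin> fv p} - fv q" by auto
    then show ?thesis using that finite_fv by simp
  qed
  define \<Delta> where "\<Delta> = insert (from_nat n) (henkin \<Gamma> n)"
  have inf: "infinite {t. \<forall>p \<in> \<Delta>. t \<notin> fv p}"
    unfolding \<Delta>_def by (rule fresh) (use Suc in simp)
  show ?case
  proof (cases "consistent \<Delta>")
    case False
    then show ?thesis using Suc by (simp add: \<Delta>_def)
  next
    case True
    then have eq: "henkin \<Gamma> (Suc n) = \<Delta> \<union> witness \<Delta> (from_nat n)"
      by (simp add: \<Delta>_def)
    have "infinite {t. \<forall>p \<in> \<Delta> \<union> witness \<Delta> (from_nat n). t \<notin> fv p}"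
    proof -
      consider "witness \<Delta> (from_nat n) = {}" | q where "witness \<Delta> (from_nat n) = {q}"
        using witness_cases by blast
      then show ?thesis
      proof cases
        case 1
        then show ?thesis using inf by simp
      next
        case 2
        then show ?thesis using fresh[OF inf, of q] by simp
      qed
    qed
    moreover have "consistent (\<Delta> \<union> witness \<Delta> (from_nat n))"
    proof (cases "\<exists>q. from_nat n = Imp (Forall q) Bot")
      case False
      then have "witness \<Delta> (from_nat n) = {}"
        using witness_cases by blast
      then show ?thesis using True by simp
    next
      case ex: True
      then obtain q where q: "from_nat n = Imp (Forall q) Bot" by blast
      define t where "t = (SOME t. \<forall>r \<in> \<Delta>. t \<notin> fv r)"
      have "\<exists>t. \<forall>r \<in> \<Delta>. t \<notin> fv r"
        using inf by (metis (mono_tags, lifting) emptyE finite.emptyI mem_Collect_eq subsetI subset_antisym)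
      then have t: "\<forall>r \<in> \<Delta>. t \<notin> fv r"
        unfolding t_def by (rule someI_ex)
      have w: "witness \<Delta> (from_nat n) = {Imp (inst t q) Bot}"
        by (simp add: witness_def q t_def)
      have mem: "Imp (Forall q) Bot \<in> \<Delta>" by (simp add: \<Delta>_def q)
      show ?thesis
      proof
        assume "\<Delta> \<union> witness \<Delta> (from_nat n) \<turnstile> Bot"
        \<comment> \<open>By \<open>Contr\<close> the instance at the fresh \<open>t\<close> is
          derivable, so generalising over \<open>t\<close> contradicts the negated universal formula
          in \<open>\<Delta>\<close>.\<close>
        then have "\<Delta> \<turnstile> inst t q" using w by (auto intro: provable.Contr)
        then have "\<Delta> \<turnstile> Forall q"
          using generalize_fresh t mem by (metis UnI1 fv.simps(4))
        then show False
          using True mem by (meson provable.Assm provable.ImpE)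
      qed
    qed
    ultimately show ?thesis unfolding eq by blast
  qed
qed

section \<open>Satisfaction and the canonical model\<close>

primrec sat :: "'a set \<Rightarrow> ('a \<Rightarrow> 'a \<Rightarrow> bool) \<Rightarrow> (nat \<Rightarrow> 'a) \<Rightarrow> fm \<Rightarrow> bool" where
  "sat D E e Bot = False"
| "sat D E e (Mem i j) = E (e i) (e j)"
| "sat D E e (Eq i j) = (e i = e j)"
| "sat D E e (Imp p q) = (sat D E e p \<longrightarrow> sat D E e q)"
| "sat D E e (Forall p) = (\<forall>a \<in> D. sat D E (case_nat a e) p)"

lemma sat_cong: "(\<And>i. i \<in> fv p \<Longrightarrow> e i = e' i) \<Longrightarrow> sat D E e p = sat D E e' p"
proof (induction p arbitrary: e e')
  case (Forall p)
  have "sat D E (case_nat a e) p = sat D E (case_nat a e') p" for a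
    by (rule Forall.IH) (auto split: nat.split simp: Forall.prems)
  then show ?case by simp
next
  case (Imp p q)
  have "sat D E e p = sat D E e' p" "sat D E e q = sat D E e' q"
    by (rule Imp.IH, simp add: Imp.prems)+
  then show ?case by simp
qed auto

lemma sat_ren: "sat D E e (ren f p) = sat D E (\<lambda>i. e (f i)) p"
proof (induction p arbitrary: e f)
  case (Forall p)
  have "(\<lambda>i. case_nat a e (case_nat 0 (\<lambda>i. Suc (f i)) i)) = case_nat a (\<lambda>i. e (f i))" for a
    by (auto split: nat.split)
  then show ?case by (simp add: Forall)
qed auto

text \<open>Truth is invariant under isomorphism; this serves to turn a domain that is a set of
  numbers into the whole type.\<close>

lemma sat_bij:
  assumes "bij_betw h D D'" and "range e \<subseteq> D"
  shows "sat D' (\<lambda>x y. E (inv_into D h x) (inv_into D h y)) (\<lambda>i. h (e i)) p = sat D E e p"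
  using assms(2)
proof (induction p arbitrary: e)
  case (Mem i j)
  then show ?case
    using assms(1) by (simp add: bij_betw_inv_into_left range_subsetD)
next
  case (Eq i j)
  then show ?case
    using assms(1) by (auto simp: bij_betw_def inj_on_eq_iff range_subsetD)
next
  case (Forall p)
  let ?E = "\<lambda>x y. E (inv_into D h x) (inv_into D h y)"
  have "sat D' ?E (case_nat (h a) (\<lambda>i. h (e i))) p = sat D E (case_nat a e) p" if "a \<in> D" for a
  proof -
    have "range (case_nat a e) \<subseteq> D" using that Forall.prems by (auto simp: range_subsetD split: nat.split)
    moreover have "case_nat (h a) (\<lambda>i. h (e i)) = (\<lambda>i. h (case_nat a e i))"
      by (auto split: nat.split)
    ultimately show ?thesis using Forall.IH by simp
  qed
  moreover have "D' = h ` D" using assms(1) by (simp add: bij_betw_def)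
  ultimately show ?case by simp
qed auto

text \<open>The elements of the model are the variables themselves, identified when their equality
  belongs to a maximal consistent set with witnesses.\<close>

theorem model_existence:
  assumes "consistent \<Gamma>"
  shows "\<exists>D (E :: nat \<Rightarrow> nat \<Rightarrow> bool) e. range e \<subseteq> D \<and> (\<forall>p \<in> \<Gamma>. sat D E e p)"
proof -
  txt \<open>Doubling all variables frees the odd ones for use as Henkin constants.\<close>
  define \<Gamma>' where "\<Gamma>' = ren (\<lambda>i. 2 * i) ` \<Gamma>"
  have "ren (\<lambda>i. i div 2) ` \<Gamma>' = \<Gamma>"
    by (simp add: \<Gamma>'_def image_image ren_ren ren_id)
  then have "consistent \<Gamma>'"
    using assms provable_ren[of \<Gamma>' Bot "\<lambda>i. i div 2"] by auto
  moreover have "infinite {t. \<forall>p \<in> \<Gamma>'. t \<notin> fv p}"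
  proof (rule infinite_super)
    show "range (\<lambda>i. Suc (2 * i)) \<subseteq> {t. \<forall>p \<in> \<Gamma>'. t \<notin> fv p}"
      by (auto simp: \<Gamma>'_def fv_ren image_iff) presburger
    show "infinite (range (\<lambda>i :: nat. Suc (2 * i)))"
      by (intro notI) (auto dest: finite_imageD simp: inj_on_def)
  qed
  ultimately have cons: "consistent (henkin \<Gamma>' n)" for n
    using henkin_consistent by blast
  define H where "H = (\<Union>n. henkin \<Gamma>' n)"
  have mono: "henkin \<Gamma>' m \<subseteq> henkin \<Gamma>' n" if "m \<le> n" for m n
    by (rule lift_Suc_mono_le[OF _ that]) (auto simp: Let_def)
  have H_cons: "consistent H"
  proof
    assume "H \<turnstile> Bot"
    then obtain \<Delta> where \<Delta>: "\<Delta> \<subseteq> H" "finite \<Delta>" "\<Delta> \<turnstile> Bot"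
      using finite_support by blast
    have "\<exists>n. \<Delta> \<subseteq> henkin \<Gamma>' n"
      using \<Delta>(2,1)
    proof (induction rule: finite_induct)
      case (insert p \<Delta>)
      then obtain n m where "\<Delta> \<subseteq> henkin \<Gamma>' n" "p \<in> henkin \<Gamma>' m" by (auto simp: H_def)
      then have "insert p \<Delta> \<subseteq> henkin \<Gamma>' (max n m)"
        using mono[of n "max n m"] mono[of m "max n m"] by auto
      then show ?case by blast
    qed simp
    then show False using cons \<Delta>(3) weaken by blast
  qed
  \<comment> \<open>Stage \<open>Suc (to_nat p)\<close> decides \<open>p\<close>; a rejected formula
    is inconsistent with a subset of \<open>H\<close>, hence with \<open>H\<close>.\<close>
  have dich: "p \<in> H \<or> insert p H \<turnstile> Bot" for p
  proof (cases "consistent (insert p (henkin \<Gamma>' (to_nat p)))")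
    case True
    then have "p \<in> henkin \<Gamma>' (Suc (to_nat p))" by simp
    then show ?thesis unfolding H_def by blast
  next
    case False
    moreover have "insert p (henkin \<Gamma>' (to_nat p)) \<subseteq> insert p H"
      unfolding H_def by blast
    ultimately show ?thesis using weaken by blast
  qed
  have ded: "p \<in> H \<longleftrightarrow> H \<turnstile> p" for p
    using dich[of p] H_cons cut provable.Assm by blast
  have H_Imp: "Imp p q \<in> H \<longleftrightarrow> (p \<in> H \<longrightarrow> q \<in> H)" for p q
  proof
    assume "p \<in> H \<longrightarrow> q \<in> H"
    then show "Imp p q \<in> H"
      using dich[of p] unfolding ded
      by (meson provable.ImpI provable_Bot subset_insertI weaken)
  qed (use ded provable.ImpE in blast)
  have H_Bot: "Bot \<notin> H" using ded H_cons by blast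
  have H_Forall: "Forall q \<in> H \<longleftrightarrow> (\<forall>t. inst t q \<in> H)" for q
  proof
    assume all: "\<forall>t. inst t q \<in> H"
    show "Forall q \<in> H"
    proof (rule ccontr)
      let ?p = "Imp (Forall q) Bot"
      assume "Forall q \<notin> H"
      \<comment> \<open>Since \<open>?p\<close> lies in \<open>H\<close>, its own stage accepted it
        and added the negation of an instance.\<close>
      then have "?p \<in> H" using H_Imp by blast
      then have "consistent (insert ?p (henkin \<Gamma>' (to_nat ?p)))"
        using H_cons weaken[of "insert ?p (henkin \<Gamma>' (to_nat ?p))" Bot H] unfolding H_def by blast
      then have "witness (insert ?p (henkin \<Gamma>' (to_nat ?p))) ?p \<subseteq> henkin \<Gamma>' (Suc (to_nat ?p))"
        by (auto simp: Let_def)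
      moreover obtain t where
        "witness (insert ?p (henkin \<Gamma>' (to_nat ?p))) ?p = {Imp (inst t q) Bot}"
        by (simp add: witness_def)
      ultimately have "\<exists>t. Imp (inst t q) Bot \<in> H"
        unfolding H_def by blast
      then show False using all H_Imp H_Bot by blast
    qed
  qed (use ded provable.AllE in blast)
  have H_refl: "Eq x x \<in> H" for x
    using ded provable.EqRefl by blast
  have H_subst: "inst y p \<in> H" if "Eq x y \<in> H" "inst x p \<in> H" for x y p
    using that ded provable.EqSubst by blast
  \<comment> \<open>In the substituted formulas index 0 is the hole filled by \<open>inst\<close>,
    and a fixed variable \<open>x\<close> is therefore written \<open>Suc x\<close>.\<close>
  have H_sym: "Eq y x \<in> H" if "Eq x y \<in> H" for x y
    using H_subst[OF that, of "Eq 0 (Suc x)"] H_refl by (simp add: inst_def)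
  have H_trans: "Eq x z \<in> H" if "Eq x y \<in> H" "Eq y z \<in> H" for x y z
    using H_subst[OF that(2), of "Eq (Suc x) 0"] that(1) by (simp add: inst_def)
  have H_Mem: "Mem x' y' \<in> H" if "Eq x x' \<in> H" "Eq y y' \<in> H" "Mem x y \<in> H" for x y x' y'
    using H_subst[OF that(1), of "Mem 0 (Suc y)"] H_subst[OF that(2), of "Mem (Suc x') 0"] that(3)
    by (simp add: inst_def)
  \<comment> \<open>The least variable of each class represents it, which realises the quotient
    inside \<open>nat\<close>.\<close>
  define r where "r x = (LEAST y. Eq x y \<in> H)" for x
  have r: "Eq x (r x) \<in> H" for x
    unfolding r_def using H_refl by (rule LeastI)
  have r_eq: "r x = r y \<longleftrightarrow> Eq x y \<in> H" for x y
  proof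
    assume "Eq x y \<in> H"
    then have "Eq x z \<in> H \<longleftrightarrow> Eq y z \<in> H" for z using H_sym H_trans by blast
    then show "r x = r y" by (simp add: r_def)
  qed (metis r H_sym H_trans)
  let ?E = "\<lambda>x y. Mem x y \<in> H"
  \<comment> \<open>Stated for every renaming \<open>f\<close>, because in the quantifier case the
    element \<open>r a\<close> is recorded by extending \<open>f\<close> with \<open>a\<close> at
    index 0.\<close>
  have truth: "sat (range r) ?E (\<lambda>i. r (f i)) p \<longleftrightarrow> ren f p \<in> H" for f p
  proof (induction p arbitrary: f)
    case (Mem i j)
    then show ?case using H_Mem r H_sym by (metis ren.simps(2) sat.simps(2))
  next
    case (Forall p)
    have "sat (range r) ?E (case_nat (r a) (\<lambda>i. r (f i))) p
        \<longleftrightarrow> inst a (ren (case_nat 0 (\<lambda>i. Suc (f i))) p) \<in> H" for a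
    proof -
      have "case_nat (r a) (\<lambda>i. r (f i)) = (\<lambda>i. r (case_nat a f i))"
        by (auto split: nat.split)
      moreover have "inst a (ren (case_nat 0 (\<lambda>i. Suc (f i))) p) = ren (case_nat a f) p"
        unfolding inst_def ren_ren by (rule ren_cong) (auto split: nat.split)
      ultimately show ?thesis using Forall.IH by simp
    qed
    then show ?case using H_Forall by simp
  qed (auto simp: H_Bot H_Imp r_eq)
  have "\<forall>p \<in> \<Gamma>. sat (range r) ?E (\<lambda>i. r (2 * i)) p"
  proof
    fix p assume "p \<in> \<Gamma>"
    then have "ren (\<lambda>i. 2 * i) p \<in> henkin \<Gamma>' 0" by (simp add: \<Gamma>'_def)
    then have "ren (\<lambda>i. 2 * i) p \<in> H" unfolding H_def by blast
    then show "sat (range r) ?E (\<lambda>i. r (2 * i)) p" by (simp only: truth)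
  qed
  then show ?thesis
    by (intro exI[of _ "range r"] exI[of _ ?E] exI[of _ "\<lambda>i. r (2 * i)"] conjI) auto
qed

theorem completeness:
  assumes "\<And>D (E :: nat \<Rightarrow> nat \<Rightarrow> bool) e.
    range e \<subseteq> D \<Longrightarrow> (\<forall>q \<in> \<Gamma>. sat D E e q) \<Longrightarrow> sat D E e p"
  shows "\<Gamma> \<turnstile> p"
proof (rule ccontr)
  assume "\<not> \<Gamma> \<turnstile> p"
  then have "consistent (insert (Imp p Bot) \<Gamma>)" using provable.Contr by blast
  then show False using model_existence[of "insert (Imp p Bot) \<Gamma>"] assms by fastforce
qed

section \<open>Truth of formulas in level notation\<close>

definition lenv :: "nat \<Rightarrow> (nat \<Rightarrow> 'a) \<Rightarrow> (nat \<Rightarrow> 'a) \<Rightarrow> nat \<Rightarrow> 'a" where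
  "lenv d e r i = (if i < d then r (d - Suc i) else e (i - d))"

text \<open>Truth of a formula in level notation at depth \<open>d\<close>: \<open>r\<close> assigns values to levels, and \<open>e\<close>
  to the indices \<open>\<ge> d\<close>, which are those of the free variables of the whole formula.\<close>

definition lsat ::
  "'a set \<Rightarrow> ('a \<Rightarrow> 'a \<Rightarrow> bool) \<Rightarrow> (nat \<Rightarrow> 'a) \<Rightarrow> nat \<Rightarrow> (nat \<Rightarrow> 'a) \<Rightarrow> lfm \<Rightarrow> bool" where
  "lsat D E e d r P = sat D E (lenv d e r) (P d)"

lemma lsat_0: "lsat D E e 0 r P = sat D E e (P 0)"
  by (simp add: lsat_def lenv_def[abs_def])

lemma lsat_mem [simp]: "x < d \<Longrightarrow> y < d \<Longrightarrow> lsat D E e d r (x \<^bold>\<in> y) = E (r x) (r y)"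
  by (simp add: lsat_def lmem_def lenv_def)

lemma lsat_eql [simp]: "x < d \<Longrightarrow> y < d \<Longrightarrow> lsat D E e d r (x \<^bold>= y) = (r x = r y)"
  by (simp add: lsat_def leql_def lenv_def)

lemma lsat_imp [simp]: "lsat D E e d r (P \<^bold>\<longrightarrow> Q) = (lsat D E e d r P \<longrightarrow> lsat D E e d r Q)"
  by (simp add: lsat_def limp_def)

lemma lsat_neg [simp]: "lsat D E e d r (\<^bold>\<not> P) = (\<not> lsat D E e d r P)"
  by (simp add: lsat_def lneg_def limp_def)

lemma lsat_conj [simp]: "lsat D E e d r (P \<^bold>\<and> Q) = (lsat D E e d r P \<and> lsat D E e d r Q)"
  by (simp add: lconj_def)

lemma lsat_disj [simp]: "lsat D E e d r (P \<^bold>\<or> Q) = (lsat D E e d r P \<or> lsat D E e d r Q)"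
  by (auto simp add: ldisj_def)

lemma lsat_iff [simp]: "lsat D E e d r (P \<^bold>\<longleftrightarrow> Q) = (lsat D E e d r P = lsat D E e d r Q)"
  by (auto simp add: liff_def)

text \<open>A quantifier met at depth \<open>d\<close> binds level \<open>d\<close>. This is index 0
  at depth \<open>Suc d\<close>, and the levels below \<open>d\<close> keep their values.\<close>

lemma case_nat_lenv: "case_nat a (lenv d e r) = lenv (Suc d) e (r(d := a))"
  by (auto simp: lenv_def fun_eq_iff split: nat.split)

lemma lsat_forall [simp]:
  "lsat D E e d r (\<^bold>\<forall>x. P x) = (\<forall>a \<in> D. lsat D E e (Suc d) (r(d := a)) (P d))"
  by (simp add: lsat_def lforall_def case_nat_lenv)

lemma lsat_exists [simp]:
  "lsat D E e d r (\<^bold>\<exists>x. P x) = (\<exists>a \<in> D. lsat D E e (Suc d) (r(d := a)) (P d))"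
  by (simp add: lexists_def)

lemma lsat_app:
  assumes "fv_below (length xs) p" and "\<And>x. x \<in> set xs \<Longrightarrow> x < d"
  shows "lsat D E e d r (app p xs) = sat D E (\<lambda>i. r (xs ! i)) p"
  unfolding lsat_def app_def sat_ren
proof (rule sat_cong)
  fix i assume "i \<in> fv p"
  then have "xs ! i < d" using assms by (auto simp: fv_below_iff)
  then show "lenv d e r (d - Suc (xs ! i)) = r (xs ! i)" by (simp add: lenv_def)
qed

text \<open>Strips the quantifiers of a universal closure. The starting depth \<open>k\<close> is
  general for the induction; each quantifier is instantiated with the value that \<open>r'\<close>
  prescribes for its level.\<close>

lemma sat_Forall_funpow:
  "sat UNIV E (lenv k e r) ((Forall ^^ m) q) \<Longrightarrow> (\<And>i. i < k \<Longrightarrow> r i = r' i)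
    \<Longrightarrow> sat UNIV E (lenv (k + m) e r') q"
proof (induction m arbitrary: k r)
  case 0
  have "lenv k e r = lenv k e r'" using 0(2) by (auto simp: lenv_def)
  then show ?case using 0 by simp
next
  case (Suc m)
  have "sat UNIV E (lenv (Suc k) e (r(k := r' k))) ((Forall ^^ m) q)"
    using Suc.prems(1) by (simp add: case_nat_lenv)
  then have "sat UNIV E (lenv (Suc k + m) e r') q"
    by (rule Suc.IH) (use Suc.prems(2) in auto)
  then show ?case by simp
qed

lemma sat_closure: "sat UNIV E e (closure n P) \<Longrightarrow> lsat UNIV E e n r P"
  using sat_Forall_funpow[of E 0 e r n "P n" r]
  by (simp add: closure_def lsat_def lenv_def[abs_def])

section \<open>Models of ZF\<close>

text \<open>Singletons give an injection of a model into itself that misses the empty set.\<close>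

lemma ZF_model_infinite:
  assumes "\<forall>p \<in> ZF. sat D E e p"
  shows "infinite D"
proof
  assume "finite D"
  have "sat D E e (pairing 0)" "sat D E e (infinity 0)"
    using assms by (auto simp: ZF_def)
  then have pairing: "lsat D E e 0 e pairing" and infinity: "lsat D E e 0 e infinity"
    by (simp_all add: lsat_0)
  have "\<forall>x \<in> D. \<exists>z \<in> D. \<forall>w \<in> D. E w z \<longleftrightarrow> w = x"
    using pairing by (simp add: pairing_def is_upair_def) blast
  then obtain s where s: "\<And>x. x \<in> D \<Longrightarrow> s x \<in> D \<and> (\<forall>w \<in> D. E w (s x) \<longleftrightarrow> w = x)" by metis
  then have "inj_on s D" by (metis inj_onI)
  then have "s ` D = D"
    using s \<open>finite D\<close> by (meson endo_inj_surj image_subsetI)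
  moreover obtain a where "a \<in> D" "\<forall>w \<in> D. \<not> E w a"
    using infinity by (auto simp: infinity_def is_inductive_def is_empty_def)
  ultimately show False using s by (metis imageE)
qed

text \<open>A model with domain in \<open>nat\<close> is infinite, so an enumeration of the domain
  transports it to all of \<open>nat\<close>.\<close>

theorem ZF_completeness:
  assumes "\<And>(E :: nat \<Rightarrow> nat \<Rightarrow> bool) e.
    (\<forall>q \<in> ZF. sat UNIV E e q) \<Longrightarrow> sat UNIV E e p"
  shows "ZF \<turnstile> p"
proof (rule completeness)
  fix D and E :: "nat \<Rightarrow> nat \<Rightarrow> bool" and e
  assume D: "range e \<subseteq> D" and ZF: "\<forall>q \<in> ZF. sat D E e q"
  obtain h where "bij_betw h (UNIV :: nat set) D"
    using bij_enumerate[OF ZF_model_infinite[OF ZF]] by blast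
  then have "bij_betw (inv_into UNIV h) D UNIV"
    by (rule bij_betw_inv_into)
  note iso = sat_bij[OF this D]
  show "sat D E e p"
    using assms ZF unfolding iso[symmetric] by blast
qed

locale ZF_model =
  fixes E :: "'a \<Rightarrow> 'a \<Rightarrow> bool" (infix "\<epsilon>" 50)
    and e\<^sub>0 :: "nat \<Rightarrow> 'a"
  assumes axioms: "p \<in> ZF \<Longrightarrow> sat UNIV E e\<^sub>0 p"
begin

subsection \<open>Definability\<close>

text \<open>A value \<open>Inl a\<close> of \<open>\<sigma>\<close> is a parameter, and \<open>Inr j\<close> refers to the environment.\<close>

definition definable :: "((nat \<Rightarrow> 'a) \<Rightarrow> bool) \<Rightarrow> bool" where
  "definable P \<longleftrightarrow>
     (\<exists>p (\<sigma> :: nat \<Rightarrow> 'a + nat). \<forall>e. P e = sat UNIV E (\<lambda>i. case_sum id e (\<sigma> i)) p)"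

text \<open>Definability of the graph: index 0 holds the value and the arguments are shifted by
  one.\<close>

definition tdef :: "((nat \<Rightarrow> 'a) \<Rightarrow> 'a) \<Rightarrow> bool" where
  "tdef t \<longleftrightarrow> definable (\<lambda>e. e 0 = t (\<lambda>i. e (Suc i)))"

text \<open>Collects closure rules that follow the syntax of a predicate or term, so that
  \<open>intro dfn\<close> proves most definability claims.\<close>

named_theorems dfn

lemma definable_subst:
  assumes "definable P"
  shows "definable (\<lambda>e. P (\<lambda>i. case_sum id e (\<tau> i)))"
proof -
  obtain p and \<sigma> :: "nat \<Rightarrow> 'a + nat" where "\<And>e. P e = sat UNIV E (\<lambda>i. case_sum id e (\<sigma> i)) p"
    using assms unfolding definable_def by blast
  moreover have "case_sum id (\<lambda>i. case_sum id e (\<tau> i)) s = case_sum id e (case_sum Inl \<tau> s)"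
    for e and s :: "'a + nat"
    by (simp split: sum.split)
  ultimately show ?thesis
    unfolding definable_def by (intro exI[of _ p] exI[of _ "\<lambda>i. case_sum Inl \<tau> (\<sigma> i)"]) simp
qed

lemma definable_ren: "definable P \<Longrightarrow> definable (\<lambda>e. P (\<lambda>i. e (f i)))"
  using definable_subst[of P "\<lambda>i. Inr (f i)"] by simp

lemma definable_const [dfn]: "definable (\<lambda>e. b)"
  unfolding definable_def by (rule exI[of _ "if b then Imp Bot Bot else Bot"]) simp

lemma definable_imp [dfn]:
  assumes "definable P" and "definable Q"
  shows "definable (\<lambda>e. P e \<longrightarrow> Q e)"
proof -
  obtain p q and \<sigma> \<tau> :: "nat \<Rightarrow> 'a + nat"
    where pq: "\<And>e. P e = sat UNIV E (\<lambda>i. case_sum id e (\<sigma> i)) p"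
      "\<And>e. Q e = sat UNIV E (\<lambda>i. case_sum id e (\<tau> i)) q"
    using assms unfolding definable_def by blast
  \<comment> \<open>The two formulas may use the same index differently; even and odd indices keep
    their assignments apart.\<close>
  define \<rho> where "\<rho> i = (if even i then \<sigma> (i div 2) else \<tau> (i div 2))" for i
  show ?thesis
    unfolding definable_def
    by (rule exI[of _ "Imp (ren (\<lambda>i. 2 * i) p) (ren (\<lambda>i. Suc (2 * i)) q)"])
      (auto intro!: exI[of _ \<rho>] simp: pq sat_ren \<rho>_def)
qed

lemma definable_all [dfn]:
  assumes "definable (\<lambda>e. P (e 0) (\<lambda>i. e (Suc i)))"
  shows "definable (\<lambda>e. \<forall>x. P x e)"
proof -
  obtain p and \<sigma> :: "nat \<Rightarrow> 'a + nat"
    where p: "\<And>e. P (e 0) (\<lambda>i. e (Suc i)) = sat UNIV E (\<lambda>i. case_sum id e (\<sigma> i)) p"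
    using assms unfolding definable_def by blast
  \<comment> \<open>All indices that refer to the quantified entry are merged into the bound index
    0. Other references drop by one; the entry of \<open>\<tau>\<close> at a merged index is a
    dummy.\<close>
  define f where "f i = (if \<sigma> i = Inr 0 then 0 else Suc i)" for i
  define \<tau> where "\<tau> i = (case \<sigma> i of Inl a \<Rightarrow> Inl a | Inr j \<Rightarrow> Inr (j - 1))" for i
  have "P x e = sat UNIV E (case_nat x (\<lambda>i. case_sum id e (\<tau> i))) (ren f p)" for x e
  proof -
    have "P x e = sat UNIV E (\<lambda>i. case_sum id (case_nat x e) (\<sigma> i)) p"
      using p[of "case_nat x e"] by simp
    moreover have "case_sum id (case_nat x e) (\<sigma> i)
        = case_nat x (\<lambda>i. case_sum id e (\<tau> i)) (f i)" for i
      by (auto simp: f_def \<tau>_def split: sum.split nat.split)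
    ultimately show ?thesis by (simp add: sat_ren)
  qed
  then show ?thesis
    unfolding definable_def by (intro exI[of _ "Forall (ren f p)"] exI[of _ \<tau>]) simp
qed

lemma definable_not [dfn]: "definable P \<Longrightarrow> definable (\<lambda>e. \<not> P e)"
  using definable_imp[of P "\<lambda>_. False"] definable_const by simp

lemma definable_conj [dfn]: "definable P \<Longrightarrow> definable Q \<Longrightarrow> definable (\<lambda>e. P e \<and> Q e)"
  using definable_not[of "\<lambda>e. P e \<longrightarrow> \<not> Q e"] definable_imp definable_not by simp

lemma definable_disj [dfn]: "definable P \<Longrightarrow> definable Q \<Longrightarrow> definable (\<lambda>e. P e \<or> Q e)"
  using definable_imp[of "\<lambda>e. \<not> P e" Q] definable_not by (simp add: imp_conv_disj)

lemma definable_iff [dfn]: "definable P \<Longrightarrow> definable Q \<Longrightarrow> definable (\<lambda>e. P e \<longleftrightarrow> Q e)"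
  using definable_conj[of "\<lambda>e. P e \<longrightarrow> Q e" "\<lambda>e. Q e \<longrightarrow> P e"] definable_imp
  by (simp add: iff_conv_conj_imp)

lemma definable_ex [dfn]:
  "definable (\<lambda>e. P (e 0) (\<lambda>i. e (Suc i))) \<Longrightarrow> definable (\<lambda>e. \<exists>x. P x e)"
  using definable_not[OF definable_all[of "\<lambda>x e. \<not> P x e"]] definable_not by simp

lemma definable_eq_var: "definable (\<lambda>e. e i = e j)"
  unfolding definable_def by (rule exI[of _ "Eq i j"]) (auto intro!: exI[of _ Inr])

lemma definable_mem_var: "definable (\<lambda>e. e i \<epsilon> e j)"
  unfolding definable_def by (rule exI[of _ "Mem i j"]) (auto intro!: exI[of _ Inr])

lemma tdef_var [dfn]: "tdef (\<lambda>e. e i)"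
  unfolding tdef_def by (rule definable_eq_var)

lemma tdef_const [dfn]: "tdef (\<lambda>e. a)"
  unfolding tdef_def using definable_subst[OF definable_eq_var[of 0 1], of "case_nat (Inr 0) (\<lambda>_. Inl a)"]
  by simp

lemma tdef_ren: "tdef t \<Longrightarrow> tdef (\<lambda>e. t (\<lambda>i. e (f i)))"
  unfolding tdef_def
  using definable_ren[of "\<lambda>e. e 0 = t (\<lambda>i. e (Suc i))" "case_nat 0 (\<lambda>i. Suc (f i))"] by simp

text \<open>The value of the term is named by an existential quantifier, so that only its graph
  enters the formula.\<close>

lemma definable_comp:
  assumes "definable (\<lambda>e. R (e 0))" and "tdef t"
  shows "definable (\<lambda>e. R (t e))"
proof -
  have "definable (\<lambda>e. \<exists>x. x = t e \<and> R x)"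
    by (intro definable_ex definable_conj assms(1)) (use assms(2) in \<open>simp add: tdef_def\<close>)
  then show ?thesis by simp
qed

lemma definable_comp2:
  assumes R: "definable (\<lambda>e. R (e 0) (e 1))" and s: "tdef s" and t: "tdef t"
  shows "definable (\<lambda>e. R (s e) (t e))"
proof -
  have "definable (\<lambda>e. \<exists>y. y = t e \<and> (\<exists>x. x = s e \<and> R x y))"
    using t tdef_ren[OF s, of Suc] R unfolding tdef_def
    by (intro definable_ex definable_conj) simp_all
  then show ?thesis by simp
qed

lemma definable_comp3:
  assumes R: "definable (\<lambda>e. R (e 0) (e 1) (e 2))" and s: "tdef s" and t: "tdef t" and u: "tdef u"
  shows "definable (\<lambda>e. R (s e) (t e) (u e))"
proof -
  have "definable (\<lambda>e. \<exists>z. z = u e \<and> (\<exists>y. y = t e \<and> (\<exists>x. x = s e \<and> R x y z)))"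
    using u tdef_ren[OF t, of Suc] tdef_ren[OF s, of "\<lambda>i. Suc (Suc i)"] R unfolding tdef_def
    by (intro definable_ex definable_conj) (simp_all add: numeral_2_eq_2)
  then show ?thesis by simp
qed

lemma definable_mem [dfn]: "tdef s \<Longrightarrow> tdef t \<Longrightarrow> definable (\<lambda>e. s e \<epsilon> t e)"
  by (rule definable_comp2[of "(\<epsilon>)"]) (rule definable_mem_var)

lemma definable_eq [dfn]: "tdef s \<Longrightarrow> tdef t \<Longrightarrow> definable (\<lambda>e. s e = t e)"
  by (rule definable_comp2[of "(=)"]) (rule definable_eq_var)

lemma tdef_comp: "tdef (\<lambda>e. f (e 0)) \<Longrightarrow> tdef t \<Longrightarrow> tdef (\<lambda>e. f (t e))"
  using definable_comp2[of "\<lambda>x y. x = f y" "\<lambda>e. e 0" "\<lambda>e. t (\<lambda>i. e (Suc i))"]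
    tdef_var tdef_ren[of t Suc] by (simp add: tdef_def)

lemma tdef_comp2: "tdef (\<lambda>e. f (e 0) (e 1)) \<Longrightarrow> tdef s \<Longrightarrow> tdef t \<Longrightarrow> tdef (\<lambda>e. f (s e) (t e))"
  using definable_comp3[of "\<lambda>x y z. x = f y z" "\<lambda>e. e 0" "\<lambda>e. s (\<lambda>i. e (Suc i))" "\<lambda>e. t (\<lambda>i. e (Suc i))"]
    tdef_var tdef_ren[of s Suc] tdef_ren[of t Suc] by (simp add: tdef_def numeral_2_eq_2)

lemma tdef_if [dfn]:
  assumes "definable P" and "tdef s" and "tdef t"
  shows "tdef (\<lambda>e. if P e then s e else t e)"
proof -
  have "definable (\<lambda>e. P (\<lambda>i. e (Suc i)) \<and> e 0 = s (\<lambda>i. e (Suc i)) \<or>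
      \<not> P (\<lambda>i. e (Suc i)) \<and> e 0 = t (\<lambda>i. e (Suc i)))"
    using assms(2,3) definable_ren[OF assms(1), of Suc]
    by (intro definable_disj definable_conj definable_not) (simp_all add: tdef_def)
  moreover have "(P (\<lambda>i. e (Suc i)) \<and> e 0 = s (\<lambda>i. e (Suc i)) \<or>
      \<not> P (\<lambda>i. e (Suc i)) \<and> e 0 = t (\<lambda>i. e (Suc i)))
    \<longleftrightarrow> e 0 = (if P (\<lambda>i. e (Suc i)) then s (\<lambda>i. e (Suc i)) else t (\<lambda>i. e (Suc i)))" for e
    by simp
  ultimately show ?thesis unfolding tdef_def by simp
qed

text \<open>The other entries are frozen as parameters, which leaves a predicate of one variable,
  the form that separation takes.\<close>

lemma definable_fix: "definable (\<lambda>e. P (e 0) (\<lambda>i. e (Suc i))) \<Longrightarrow> definable (\<lambda>e'. P (e' 0) e)"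
  using definable_subst[of "\<lambda>e. P (e 0) (\<lambda>i. e (Suc i))" "case_nat (Inr 0) (\<lambda>i. Inl (e i))"] by simp

lemma tdef_fix: "tdef (\<lambda>e. t (e 0) (\<lambda>i. e (Suc i))) \<Longrightarrow> tdef (\<lambda>e'. t (e' 0) e)"
  unfolding tdef_def
  using definable_subst[of "\<lambda>e. e 0 = t (e (Suc 0)) (\<lambda>i. e (Suc (Suc i)))"
      "case_nat (Inr 0) (case_nat (Inr 1) (\<lambda>i. Inl (e i)))"] by simp

text \<open>The axiom schemas require the parameters of a formula to come first, followed by the
  variables bound in the schema.\<close>

lemma definable_schema:
  assumes "definable P"
  obtains n p r c where "fv_below (n + k) p"
    and "\<And>e. sat UNIV E (\<lambda>i. if i < n then r i else e (i - n)) p = P (\<lambda>i. if i < k then e i else c)"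
proof -
  obtain p and \<sigma> :: "nat \<Rightarrow> 'a + nat"
    where p: "\<And>e. P e = sat UNIV E (\<lambda>i. case_sum id e (\<sigma> i)) p"
    using assms unfolding definable_def by blast
  obtain n where n: "\<forall>i \<in> fv p. i < n" using fv_bounded by blast
  \<comment> \<open>\<open>c\<close> is the default for environment entries from \<open>k\<close>
    on, which become parameters; \<open>f\<close> moves the first \<open>k\<close> entries behind
    the \<open>n\<close> parameters.\<close>
  define c where "c = e\<^sub>0 0"
  define f where "f i = (case \<sigma> i of Inr j \<Rightarrow> if j < k then n + j else i | Inl _ \<Rightarrow> i)" for i
  define r where "r i = (case \<sigma> i of Inr j \<Rightarrow> c | Inl a \<Rightarrow> a)" for i
  show ?thesis
  proof (rule that[of n "ren f p" r c])
    show "fv_below (n + k) (ren f p)"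
      using n by (auto simp: fv_below_iff fv_ren f_def trans_less_add1 split: sum.split)
    show "sat UNIV E (\<lambda>i. if i < n then r i else e (i - n)) (ren f p)
        = P (\<lambda>i. if i < k then e i else c)" for e
      unfolding p sat_ren
      by (rule sat_cong) (use n in \<open>auto simp: f_def r_def split: sum.split\<close>)
  qed
qed

lemma separation_ex:
  assumes "definable (\<lambda>e. P (e 0))"
  shows "\<exists>b. \<forall>x. x \<epsilon> b \<longleftrightarrow> x \<epsilon> a \<and> P x"
proof -
  obtain n p r c where fv: "fv_below (n + 1) p"
    and p: "\<And>e. sat UNIV E (\<lambda>i. if i < n then r i else e (i - n)) p = P (e 0)"
    using definable_schema[OF assms, where k = 1] by (auto; metis)
  have "sat UNIV E e\<^sub>0 (closure n (separation n p))"
    using fv by (intro axioms) (auto simp: ZF_def)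
  then have "lsat UNIV E e\<^sub>0 n r (separation n p)" by (rule sat_closure)
  then obtain b where b: "\<And>x. x \<epsilon> b \<longleftrightarrow> x \<epsilon> a \<and>
      lsat UNIV E e\<^sub>0 (n + 3) (r(n := a, n + 1 := b, n + 2 := x)) (app p ([0..<n] @ [n + 2]))"
    by (fastforce simp: separation_def numeral_eq_Suc)
  have "lsat UNIV E e\<^sub>0 (n + 3) (r(n := a, n + 1 := b, n + 2 := x)) (app p ([0..<n] @ [n + 2])) = P x" for x
  proof -
    have "lsat UNIV E e\<^sub>0 (n + 3) (r(n := a, n + 1 := b, n + 2 := x)) (app p ([0..<n] @ [n + 2]))
      = sat UNIV E (\<lambda>i. (r(n := a, n + 1 := b, n + 2 := x)) (([0..<n] @ [n + 2]) ! i)) p"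
      by (rule lsat_app) (use fv in auto)
    also have "\<dots> = sat UNIV E (\<lambda>i. if i < n then r i else (\<lambda>_. x) (i - n)) p"
      by (rule sat_cong) (use fv in \<open>auto simp: fv_below_iff nth_append less_Suc_eq\<close>)
    finally show ?thesis using p[of "\<lambda>_. x"] by simp
  qed
  then show ?thesis using b by blast
qed

lemma replacement_ex:
  assumes "definable (\<lambda>e. R (e 0) (e 1))" and "\<And>x y z. R x y \<Longrightarrow> R x z \<Longrightarrow> y = z"
  shows "\<exists>b. \<forall>y. y \<epsilon> b \<longleftrightarrow> (\<exists>x. x \<epsilon> a \<and> R x y)"
proof -
  obtain n p r c where fv: "fv_below (n + 2) p"
    and p: "\<And>e. sat UNIV E (\<lambda>i. if i < n then r i else e (i - n)) p = R (e 0) (e 1)"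
    using definable_schema[OF assms(1), where k = 2] by (auto; metis)
  have "sat UNIV E e\<^sub>0 (closure n (replacement n p))"
    using fv by (intro axioms) (auto simp: ZF_def)
  then have ax: "lsat UNIV E e\<^sub>0 n r (replacement n p)" by (rule sat_closure)
  \<comment> \<open>The schema evaluates the formula at several depths and variables, hence the
    general \<open>d\<close>, \<open>i\<close>, \<open>j\<close> and \<open>r'\<close>; only the
    parameter levels are tied to \<open>r\<close>.\<close>
  have R: "lsat UNIV E e\<^sub>0 d r' (app p ([0..<n] @ [i, j])) = R (r' i) (r' j)"
    if "i < d" "j < d" "n \<le> d" "\<And>i. i < n \<Longrightarrow> r' i = r i" for d i j r'
  proof -
    have "lsat UNIV E e\<^sub>0 d r' (app p ([0..<n] @ [i, j]))
      = sat UNIV E (\<lambda>l. r' (([0..<n] @ [i, j]) ! l)) p"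
      by (rule lsat_app) (use fv that in auto)
    also have "\<dots> = sat UNIV E (\<lambda>l. if l < n then r l else (case_nat (r' i) (\<lambda>_. r' j)) (l - n)) p"
    proof (rule sat_cong)
      fix l assume "l \<in> fv p"
      then have "l < n \<or> l = n \<or> l = Suc n" using fv by (auto simp: fv_below_iff)
      then show "r' (([0..<n] @ [i, j]) ! l)
          = (if l < n then r l else (case_nat (r' i) (\<lambda>_. r' j)) (l - n))"
        using that by (auto simp: nth_append)
    qed
    finally show ?thesis using p[of "case_nat (r' i) (\<lambda>_. r' j)"] by simp
  qed
  show ?thesis
    using ax assms(2) by (simp add: replacement_def R) blast
qed

subsection \<open>Basic operations on sets\<close>

lemma lsat_axiom: "P 0 \<in> ZF \<Longrightarrow> lsat UNIV E e\<^sub>0 0 e\<^sub>0 P"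
  by (simp add: lsat_0 axioms)

lemma extensionality_ax: "(\<And>z. z \<epsilon> x \<longleftrightarrow> z \<epsilon> y) \<Longrightarrow> x = y"
  using lsat_axiom[of extensionality]
  by (auto simp: ZF_def extensionality_def)

lemma ext_iff: "x = y \<longleftrightarrow> (\<forall>z. z \<epsilon> x \<longleftrightarrow> z \<epsilon> y)"
  using extensionality_ax by blast

text \<open>Extensionality gives uniqueness, so an existence axiom suffices to justify each of the
  descriptions below.\<close>

lemma the_set:
  assumes "\<exists>b. \<forall>x. x \<epsilon> b \<longleftrightarrow> P x"
  shows "y \<epsilon> (THE b. \<forall>x. x \<epsilon> b \<longleftrightarrow> P x) \<longleftrightarrow> P y"
proof -
  have "\<exists>!b. \<forall>x. x \<epsilon> b \<longleftrightarrow> P x"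
    using assms by (metis ext_iff)
  from theI'[OF this] show ?thesis by blast
qed

definition sub :: "'a \<Rightarrow> 'a \<Rightarrow> bool" (infix "\<sqsubseteq>" 50) where
  "x \<sqsubseteq> y \<longleftrightarrow> (\<forall>z. z \<epsilon> x \<longrightarrow> z \<epsilon> y)"

definition sep :: "'a \<Rightarrow> ('a \<Rightarrow> bool) \<Rightarrow> 'a" where
  "sep a P = (THE b. \<forall>x. x \<epsilon> b \<longleftrightarrow> x \<epsilon> a \<and> P x)"

definition img :: "'a \<Rightarrow> ('a \<Rightarrow> 'a) \<Rightarrow> 'a" where
  "img a t = (THE b. \<forall>y. y \<epsilon> b \<longleftrightarrow> (\<exists>x. x \<epsilon> a \<and> y = t x))"

text \<open>\<open>e\<^sub>0 0\<close> is just some element of the model to separate from.\<close>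

definition emp :: 'a where
  "emp = sep (e\<^sub>0 0) (\<lambda>_. False)"

definition upair :: "'a \<Rightarrow> 'a \<Rightarrow> 'a" where
  "upair x y = (THE b. \<forall>z. z \<epsilon> b \<longleftrightarrow> z = x \<or> z = y)"

definition Uni :: "'a \<Rightarrow> 'a" where
  "Uni a = (THE b. \<forall>x. x \<epsilon> b \<longleftrightarrow> (\<exists>y. y \<epsilon> a \<and> x \<epsilon> y))"

definition pow :: "'a \<Rightarrow> 'a" where
  "pow a = (THE b. \<forall>x. x \<epsilon> b \<longleftrightarrow> x \<sqsubseteq> a)"

definition cup :: "'a \<Rightarrow> 'a \<Rightarrow> 'a" where
  "cup x y = Uni (upair x y)"

definition adj :: "'a \<Rightarrow> 'a \<Rightarrow> 'a" where
  "adj x y = cup x (upair y y)"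

definition diff :: "'a \<Rightarrow> 'a \<Rightarrow> 'a" where
  "diff x y = sep x (\<lambda>z. \<not> z \<epsilon> y)"

definition pr :: "'a \<Rightarrow> 'a \<Rightarrow> 'a" where
  "pr x y = upair (upair x x) (upair x y)"

definition prd :: "'a \<Rightarrow> 'a \<Rightarrow> 'a" where
  "prd a b = Uni (img a (\<lambda>x. img b (\<lambda>y. pr x y)))"

text \<open>The union of all values of \<open>f\<close> at \<open>x\<close>, which is the value
  itself when it is unique; this makes application a total definable operation.
  \<open>Uni (Uni f)\<close> contains the values because pairs are Kuratowski pairs.\<close>

definition ap :: "'a \<Rightarrow> 'a \<Rightarrow> 'a" (infixl "\<cdot>" 90) where
  "f \<cdot> x = Uni (sep (Uni (Uni f)) (\<lambda>y. pr x y \<epsilon> f))"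

definition lam :: "'a \<Rightarrow> ('a \<Rightarrow> 'a) \<Rightarrow> 'a" where
  "lam a t = img a (\<lambda>x. pr x (t x))"

lemma mem_sep: "definable (\<lambda>e. P (e 0)) \<Longrightarrow> x \<epsilon> sep a P \<longleftrightarrow> x \<epsilon> a \<and> P x"
  unfolding sep_def by (rule the_set) (rule separation_ex)

lemma mem_img: "tdef (\<lambda>e. t (e 0)) \<Longrightarrow> y \<epsilon> img a t \<longleftrightarrow> (\<exists>x. x \<epsilon> a \<and> y = t x)"
  unfolding img_def
  by (rule the_set, rule replacement_ex)
    (auto intro: definable_eq tdef_var tdef_ren[of "\<lambda>e. t (e 0)" "\<lambda>i. i"])

lemma mem_emp [simp]: "\<not> x \<epsilon> emp"
  by (simp add: emp_def mem_sep definable_const)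

lemma mem_upair [simp]: "z \<epsilon> upair x y \<longleftrightarrow> z = x \<or> z = y"
  unfolding upair_def
  by (rule the_set)
    (use lsat_axiom[of pairing] in \<open>simp add: ZF_def pairing_def is_upair_def\<close>)

lemma mem_Uni [simp]: "x \<epsilon> Uni a \<longleftrightarrow> (\<exists>y. y \<epsilon> a \<and> x \<epsilon> y)"
  unfolding Uni_def
  by (rule the_set)
    (use lsat_axiom[of union] in \<open>simp add: ZF_def union_def\<close>)

lemma mem_pow [simp]: "x \<epsilon> pow a \<longleftrightarrow> x \<sqsubseteq> a"
  unfolding pow_def
  by (rule the_set)
    (use lsat_axiom[of powerset] in \<open>simp add: ZF_def powerset_def lsub_def sub_def\<close>)

lemma foundation_ax: "x \<epsilon> a \<Longrightarrow> \<exists>y. y \<epsilon> a \<and> (\<forall>z. z \<epsilon> a \<longrightarrow> \<not> z \<epsilon> y)"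
  using lsat_axiom[of foundation]
  by (simp add: ZF_def foundation_def is_empty_def) blast

lemma mem_cup [simp]: "z \<epsilon> cup x y \<longleftrightarrow> z \<epsilon> x \<or> z \<epsilon> y"
  by (auto simp: cup_def)

lemma mem_adj [simp]: "z \<epsilon> adj x y \<longleftrightarrow> z \<epsilon> x \<or> z = y"
  by (auto simp: adj_def)

text \<open>By extensionality the graph of an operation is determined by the members of its values,
  so a definable membership condition is enough.\<close>

lemma tdefI:
  assumes "\<And>x e. x \<epsilon> t e \<longleftrightarrow> Q x e" and "definable (\<lambda>e. Q (e 0) (\<lambda>i. e (Suc i)))"
  shows "tdef t"
proof -
  have "definable (\<lambda>e. Q (e 0) (\<lambda>i. e (Suc (Suc i))))"
    using definable_ren[OF assms(2), of "case_nat 0 (\<lambda>i. Suc (Suc i))"] by simp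
  then have "definable (\<lambda>e. \<forall>x. x \<epsilon> e 0 \<longleftrightarrow> Q x (\<lambda>i. e (Suc i)))"
    by (intro dfn) simp
  then show ?thesis unfolding tdef_def ext_iff assms(1) .
qed

lemma tdef_sep [dfn]:
  assumes "tdef a" and "definable (\<lambda>e. P (e 0) (\<lambda>i. e (Suc i)))"
  shows "tdef (\<lambda>e. sep (a e) (\<lambda>x. P x e))"
  by (rule tdefI, rule mem_sep, rule definable_fix[OF assms(2)])
    (intro dfn assms tdef_ren[OF assms(1)])

lemma tdef_img [dfn]:
  assumes "tdef a" and "tdef (\<lambda>e. t (e 0) (\<lambda>i. e (Suc i)))"
  shows "tdef (\<lambda>e. img (a e) (\<lambda>x. t x e))"
proof (rule tdefI, rule mem_img, rule tdef_fix[OF assms(2)])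
  show "definable (\<lambda>e. \<exists>x. x \<epsilon> a (\<lambda>i. e (Suc i)) \<and> e 0 = t x (\<lambda>i. e (Suc i)))"
    using tdef_ren[OF assms(2), of "case_nat 0 (\<lambda>i. Suc (Suc i))"]
      tdef_ren[OF assms(1), of "\<lambda>i. Suc (Suc i)"]
    by (intro dfn) simp_all
qed

lemma definable_sub [dfn]: "tdef s \<Longrightarrow> tdef t \<Longrightarrow> definable (\<lambda>e. s e \<sqsubseteq> t e)"
  by (rule definable_comp2[of sub]) (unfold sub_def, intro dfn)

lemma tdef_upair [dfn]: "tdef s \<Longrightarrow> tdef t \<Longrightarrow> tdef (\<lambda>e. upair (s e) (t e))"
  by (rule tdef_comp2[of upair], rule tdefI, rule mem_upair, intro dfn)

lemma tdef_Uni [dfn]: "tdef s \<Longrightarrow> tdef (\<lambda>e. Uni (s e))"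
  by (rule tdef_comp[of Uni], rule tdefI, rule mem_Uni, intro dfn)

lemma tdef_pow [dfn]: "tdef s \<Longrightarrow> tdef (\<lambda>e. pow (s e))"
  by (rule tdef_comp[of pow], rule tdefI, rule mem_pow, intro dfn)

lemma tdef_cup [dfn]: "tdef s \<Longrightarrow> tdef t \<Longrightarrow> tdef (\<lambda>e. cup (s e) (t e))"
  unfolding cup_def by (intro dfn)

lemma tdef_adj [dfn]: "tdef s \<Longrightarrow> tdef t \<Longrightarrow> tdef (\<lambda>e. adj (s e) (t e))"
  unfolding adj_def by (intro dfn)

lemma mem_diff [simp]: "z \<epsilon> diff x y \<longleftrightarrow> z \<epsilon> x \<and> \<not> z \<epsilon> y"
  unfolding diff_def by (rule mem_sep) (intro dfn)

lemma tdef_diff [dfn]: "tdef s \<Longrightarrow> tdef t \<Longrightarrow> tdef (\<lambda>e. diff (s e) (t e))"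
  by (rule tdef_comp2[of diff], rule tdefI, rule mem_diff, intro dfn)

lemma upair_eq: "upair x y = upair u v \<longleftrightarrow> x = u \<and> y = v \<or> x = v \<and> y = u"
  by (auto simp: ext_iff[of "upair x y"])

lemma pr_inject [simp]: "pr x y = pr u v \<longleftrightarrow> x = u \<and> y = v"
  by (auto simp: pr_def upair_eq)

lemma tdef_pr [dfn]: "tdef s \<Longrightarrow> tdef t \<Longrightarrow> tdef (\<lambda>e. pr (s e) (t e))"
  unfolding pr_def by (intro dfn)

lemma mem_prd: "p \<epsilon> prd a b \<longleftrightarrow> (\<exists>x y. x \<epsilon> a \<and> y \<epsilon> b \<and> p = pr x y)"
proof -
  have "tdef (\<lambda>e. pr x (e 0))" "tdef (\<lambda>e. img b (\<lambda>y. pr (e 0) y))" for x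
    by (intro dfn)+
  then show ?thesis by (auto simp: prd_def mem_img)
qed

lemma pr_mem_prd [simp]: "pr x y \<epsilon> prd a b \<longleftrightarrow> x \<epsilon> a \<and> y \<epsilon> b"
  by (auto simp: mem_prd)

lemma mem_ap: "z \<epsilon> f \<cdot> x \<longleftrightarrow> (\<exists>y. pr x y \<epsilon> f \<and> z \<epsilon> y)"
proof -
  have "definable (\<lambda>e. pr x (e 0) \<epsilon> f)" by (intro dfn)
  moreover have "y \<epsilon> Uni (Uni f)" if "pr x y \<epsilon> f" for y
  proof -
    have "upair x y \<epsilon> pr x y" "y \<epsilon> upair x y" by (simp_all add: pr_def)
    then show ?thesis using that by (metis mem_Uni)
  qed
  ultimately show ?thesis by (simp add: ap_def mem_sep) blast
qed

lemma tdef_ap [dfn]: "tdef s \<Longrightarrow> tdef t \<Longrightarrow> tdef (\<lambda>e. s e \<cdot> t e)"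
  by (rule tdef_comp2[of ap], rule tdefI, rule mem_ap, intro dfn)

lemma mem_lam: "tdef (\<lambda>e. t (e 0)) \<Longrightarrow> p \<epsilon> lam a t \<longleftrightarrow> (\<exists>x. x \<epsilon> a \<and> p = pr x (t x))"
  unfolding lam_def by (rule mem_img) (intro dfn)

lemma sub_refl [simp]: "x \<sqsubseteq> x"
  by (simp add: sub_def)

lemma sub_trans: "x \<sqsubseteq> y \<Longrightarrow> y \<sqsubseteq> z \<Longrightarrow> x \<sqsubseteq> z"
  by (simp add: sub_def)

lemma sub_antisym: "x \<sqsubseteq> y \<Longrightarrow> y \<sqsubseteq> x \<Longrightarrow> x = y"
  using ext_iff by (auto simp: sub_def)

lemma emp_sub [simp]: "emp \<sqsubseteq> x"
  by (simp add: sub_def)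

lemma emp_iff: "x = emp \<longleftrightarrow> (\<forall>z. \<not> z \<epsilon> x)"
  by (simp add: ext_iff)

text \<open>Foundation for the singleton of \<open>x\<close>.\<close>

lemma mem_irrefl [simp]: "\<not> x \<epsilon> x"
  using foundation_ax[of x "upair x x"] by auto

section \<open>Functions, bijections and equipotence\<close>

definition is_map :: "'a \<Rightarrow> 'a \<Rightarrow> 'a \<Rightarrow> bool" where
  "is_map f A B \<longleftrightarrow> (\<forall>p. p \<epsilon> f \<longrightarrow> (\<exists>x y. x \<epsilon> A \<and> y \<epsilon> B \<and> p = pr x y)) \<and>
     (\<forall>x. x \<epsilon> A \<longrightarrow> (\<exists>y. pr x y \<epsilon> f)) \<and>
     (\<forall>x y z. pr x y \<epsilon> f \<and> pr x z \<epsilon> f \<longrightarrow> y = z)"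

lemma definable_is_map [dfn]:
  "tdef s \<Longrightarrow> tdef t \<Longrightarrow> tdef u \<Longrightarrow> definable (\<lambda>e. is_map (s e) (t e) (u e))"
  by (rule definable_comp3[of is_map]) (unfold is_map_def, intro dfn)

lemma ap_eqI: "pr x y \<epsilon> f \<Longrightarrow> (\<And>z. pr x z \<epsilon> f \<Longrightarrow> z = y) \<Longrightarrow> f \<cdot> x = y"
  unfolding ext_iff[of "f \<cdot> x"] mem_ap by blast

text \<open>Passes from the relational form, which mirrors the formula \<open>is_fun\<close>, to
  application.\<close>

lemma is_map_mem:
  assumes "is_map f A B" shows "pr x y \<epsilon> f \<longleftrightarrow> x \<epsilon> A \<and> f \<cdot> x = y"
  using assms ap_eqI[of x _ f] unfolding is_map_def by (metis pr_inject)

lemma is_map_ap: "is_map f A B \<Longrightarrow> x \<epsilon> A \<Longrightarrow> f \<cdot> x \<epsilon> B"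
  using is_map_mem[of f A B x "f \<cdot> x"] unfolding is_map_def by (metis pr_inject)

lemma ap_lam: "tdef (\<lambda>e. t (e 0)) \<Longrightarrow> x \<epsilon> a \<Longrightarrow> lam a t \<cdot> x = t x"
  by (rule ap_eqI) (auto simp: mem_lam)

lemma is_map_lam:
  "tdef (\<lambda>e. t (e 0)) \<Longrightarrow> (\<And>x. x \<epsilon> A \<Longrightarrow> t x \<epsilon> B) \<Longrightarrow> is_map (lam A t) A B"
  by (auto simp: is_map_def mem_lam)

definition is_bijection :: "'a \<Rightarrow> 'a \<Rightarrow> 'a \<Rightarrow> bool" where
  "is_bijection f A B \<longleftrightarrow> is_map f A B \<and> (\<forall>x y z. pr x z \<epsilon> f \<and> pr y z \<epsilon> f \<longrightarrow> x = y) \<and>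
     (\<forall>y. y \<epsilon> B \<longrightarrow> (\<exists>x. pr x y \<epsilon> f))"

lemma definable_is_bijection [dfn]:
  "tdef s \<Longrightarrow> tdef t \<Longrightarrow> tdef u \<Longrightarrow> definable (\<lambda>e. is_bijection (s e) (t e) (u e))"
  by (rule definable_comp3[of is_bijection]) (unfold is_bijection_def, intro dfn)

lemma is_bijection_iff:
  "is_bijection f A B \<longleftrightarrow> is_map f A B \<and> (\<forall>x y. x \<epsilon> A \<longrightarrow> y \<epsilon> A \<longrightarrow> f \<cdot> x = f \<cdot> y \<longrightarrow> x = y) \<and>
     (\<forall>y. y \<epsilon> B \<longrightarrow> (\<exists>x. x \<epsilon> A \<and> f \<cdot> x = y))"
  unfolding is_bijection_def by (auto simp: is_map_mem)

definition eqp :: "'a \<Rightarrow> 'a \<Rightarrow> bool" where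
  "eqp A B \<longleftrightarrow> (\<exists>f. is_bijection f A B)"

lemma definable_eqp [dfn]: "tdef s \<Longrightarrow> tdef t \<Longrightarrow> definable (\<lambda>e. eqp (s e) (t e))"
  by (rule definable_comp2[of eqp]) (unfold eqp_def, intro dfn)

lemma eqpI:
  assumes "tdef (\<lambda>e. t (e 0))" and "\<And>x. x \<epsilon> A \<Longrightarrow> t x \<epsilon> B"
    and "\<And>x y. x \<epsilon> A \<Longrightarrow> y \<epsilon> A \<Longrightarrow> t x = t y \<Longrightarrow> x = y"
    and "\<And>y. y \<epsilon> B \<Longrightarrow> \<exists>x. x \<epsilon> A \<and> t x = y"
  shows "eqp A B"
  unfolding eqp_def is_bijection_iff using assms
  by (intro exI[of _ "lam A t"]) (auto simp: is_map_lam ap_lam, metis ap_lam)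

section \<open>The set of natural numbers and the value of the basic formulas\<close>

abbreviation suc :: "'a \<Rightarrow> 'a" where
  "suc n \<equiv> adj n n"

definition inductv :: "'a \<Rightarrow> bool" where
  "inductv w \<longleftrightarrow> emp \<epsilon> w \<and> (\<forall>x. x \<epsilon> w \<longrightarrow> suc x \<epsilon> w)"

lemma definable_inductv [dfn]: "tdef t \<Longrightarrow> definable (\<lambda>e. inductv (t e))"
  by (rule definable_comp[of inductv]) (unfold inductv_def, intro dfn)

definition om :: 'a where
  "om = (THE w. inductv w \<and> (\<forall>v. inductv v \<longrightarrow> w \<sqsubseteq> v))"

text \<open>This and the following evaluations translate formulas into predicates over the model;
  the level bounds are discharged by simplification as the depth grows.\<close>

lemma lsat_is_empty [simp]: "x < d \<Longrightarrow> lsat UNIV E e d r (is_empty x) \<longleftrightarrow> r x = emp"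
  by (simp add: is_empty_def emp_iff)

lemma lsat_sub [simp]: "x < d \<Longrightarrow> y < d \<Longrightarrow> lsat UNIV E e d r (x \<^bold>\<subseteq> y) \<longleftrightarrow> r x \<sqsubseteq> r y"
  by (simp add: lsub_def sub_def)

lemma lsat_is_upair [simp]:
  "x < d \<Longrightarrow> y < d \<Longrightarrow> z < d \<Longrightarrow> lsat UNIV E e d r (is_upair z x y) \<longleftrightarrow> r z = upair (r x) (r y)"
  by (simp add: is_upair_def ext_iff[of "r z"])

lemma lsat_is_pair [simp]:
  "x < d \<Longrightarrow> y < d \<Longrightarrow> z < d \<Longrightarrow> lsat UNIV E e d r (is_pair z x y) \<longleftrightarrow> r z = pr (r x) (r y)"
  by (simp add: is_pair_def pr_def)

lemma lsat_is_diff [simp]: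
  "x < d \<Longrightarrow> y < d \<Longrightarrow> z < d \<Longrightarrow> lsat UNIV E e d r (is_diff z x y) \<longleftrightarrow> r z = diff (r x) (r y)"
  by (simp add: is_diff_def ext_iff[of "r z"])

lemma lsat_is_adjoin [simp]:
  "x < d \<Longrightarrow> y < d \<Longrightarrow> z < d \<Longrightarrow> lsat UNIV E e d r (is_adjoin z x y) \<longleftrightarrow> r z = adj (r x) (r y)"
  by (simp add: is_adjoin_def ext_iff[of "r z"])

lemma lsat_is_inductive [simp]:
  "x < d \<Longrightarrow> lsat UNIV E e d r (is_inductive x) \<longleftrightarrow> inductv (r x)"
  by (simp add: is_inductive_def inductv_def)

lemma lsat_maps [simp]:
  "x < d \<Longrightarrow> y < d \<Longrightarrow> f < d \<Longrightarrow> lsat UNIV E e d r (maps f x y) \<longleftrightarrow> pr (r x) (r y) \<epsilon> r f"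
  by (simp add: maps_def)

lemma lsat_is_fun [simp]:
  "A < d \<Longrightarrow> B < d \<Longrightarrow> f < d \<Longrightarrow> lsat UNIV E e d r (is_fun f A B) \<longleftrightarrow> is_map (r f) (r A) (r B)"
  by (simp add: is_fun_def is_map_def)

lemma lsat_is_bij [simp]:
  "A < d \<Longrightarrow> B < d \<Longrightarrow> f < d \<Longrightarrow> lsat UNIV E e d r (is_bij f A B) \<longleftrightarrow> is_bijection (r f) (r A) (r B)"
  by (simp add: is_bij_def is_bijection_def)

lemma lsat_equipotent [simp]:
  "A < d \<Longrightarrow> B < d \<Longrightarrow> lsat UNIV E e d r (equipotent A B) \<longleftrightarrow> eqp (r A) (r B)"
  by (simp add: equipotent_def eqp_def)

text \<open>Infinity provides some inductive set; separating from it the elements common to all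
  inductive sets yields the least one.\<close>

lemma om_eq: "w = om \<longleftrightarrow> inductv w \<and> (\<forall>v. inductv v \<longrightarrow> w \<sqsubseteq> v)"
proof -
  have "lsat UNIV E e\<^sub>0 0 e\<^sub>0 infinity"
    by (rule lsat_axiom) (simp add: ZF_def)
  then obtain w\<^sub>0 where w\<^sub>0: "inductv w\<^sub>0" by (auto simp: infinity_def)
  define w\<^sub>1 where "w\<^sub>1 = sep w\<^sub>0 (\<lambda>x. \<forall>v. inductv v \<longrightarrow> x \<epsilon> v)"
  have "definable (\<lambda>e. \<forall>v. inductv v \<longrightarrow> e 0 \<epsilon> v)" by (intro dfn)
  then have w\<^sub>1: "x \<epsilon> w\<^sub>1 \<longleftrightarrow> (\<forall>v. inductv v \<longrightarrow> x \<epsilon> v)" for x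
    using w\<^sub>0 by (auto simp: w\<^sub>1_def mem_sep)
  then have w\<^sub>1: "inductv w\<^sub>1 \<and> (\<forall>v. inductv v \<longrightarrow> w\<^sub>1 \<sqsubseteq> v)"
    by (auto simp: inductv_def sub_def)
  moreover have uniq: "w = w\<^sub>1" if "inductv w \<and> (\<forall>v. inductv v \<longrightarrow> w \<sqsubseteq> v)" for w
    using that w\<^sub>1 by (simp add: sub_antisym)
  ultimately have "om = w\<^sub>1"
    unfolding om_def by (rule the_equality)
  then show ?thesis using w\<^sub>1 uniq by blast
qed

lemma lsat_is_omega [simp]: "w < d \<Longrightarrow> lsat UNIV E e d r (is_omega w) \<longleftrightarrow> r w = om"
  by (simp add: is_omega_def om_eq)

definition fin :: "'a \<Rightarrow> bool" where
  "fin X \<longleftrightarrow> (\<exists>n. n \<epsilon> om \<and> eqp X n)"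

lemma definable_fin [dfn]: "tdef t \<Longrightarrow> definable (\<lambda>e. fin (t e))"
  by (rule definable_comp[of fin]) (unfold fin_def, intro dfn)

lemma lsat_is_finite [simp]: "x < d \<Longrightarrow> lsat UNIV E e d r (is_finite x) \<longleftrightarrow> fin (r x)"
  by (simp add: is_finite_def fin_def)

lemma lsat_is_infinite [simp]: "x < d \<Longrightarrow> lsat UNIV E e d r (is_infinite x) \<longleftrightarrow> \<not> fin (r x)"
  by (simp add: is_infinite_def)

subsection \<open>Natural numbers and finite sets\<close>

lemma emp_om [simp]: "emp \<epsilon> om" and suc_om [simp]: "n \<epsilon> om \<Longrightarrow> suc n \<epsilon> om"
  using om_eq[of om] by (auto simp: inductv_def)

lemma om_induct [consumes 1, case_names definable emp suc]:
  assumes "n \<epsilon> om" and "definable (\<lambda>e. P (e 0))"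
    and "P emp" and "\<And>n. n \<epsilon> om \<Longrightarrow> P n \<Longrightarrow> P (suc n)"
  shows "P n"
proof -
  have "inductv (sep om P)"
    using assms(3,4) by (simp add: inductv_def mem_sep[OF assms(2)])
  then have "om \<sqsubseteq> sep om P" using om_eq[of om] by blast
  then show ?thesis using assms(1) by (simp add: sub_def mem_sep[OF assms(2)])
qed

lemma om_transitive: "n \<epsilon> om \<Longrightarrow> m \<epsilon> n \<Longrightarrow> m \<epsilon> om \<and> m \<sqsubseteq> n"
proof -
  assume "n \<epsilon> om"
  then have "\<forall>m. m \<epsilon> n \<longrightarrow> m \<epsilon> om \<and> m \<sqsubseteq> n"
  proof (induction rule: om_induct)
    case definable
    show ?case by (intro dfn)
  qed (auto simp: sub_def)
  then show "m \<epsilon> n \<Longrightarrow> m \<epsilon> om \<and> m \<sqsubseteq> n" by blast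
qed

lemma suc_mem_suc:
  assumes "m \<epsilon> om" and "n \<epsilon> m" shows "suc n \<epsilon> suc m"
proof -
  have "\<forall>n. n \<epsilon> m \<longrightarrow> suc n \<epsilon> suc m"
    using assms(1)
  proof (induction rule: om_induct)
    case definable
    show ?case by (intro dfn)
  qed auto
  then show ?thesis using assms(2) by blast
qed

text \<open>Induction on \<open>n\<close> for all \<open>m\<close> at once. If \<open>n\<close>
  belongs to \<open>m\<close>, then \<open>suc n\<close> belongs to \<open>suc m\<close>, hence
  belongs to \<open>m\<close> or equals it.\<close>

lemma om_linear:
  assumes "m \<epsilon> om" and "n \<epsilon> om" shows "m \<epsilon> n \<or> m = n \<or> n \<epsilon> m"
proof -
  have zero: "emp = m \<or> emp \<epsilon> m" if "m \<epsilon> om" for m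
    using that
  proof (induction rule: om_induct)
    case definable
    show ?case by (intro dfn)
  qed auto
  have "\<forall>m. m \<epsilon> om \<longrightarrow> m \<epsilon> n \<or> m = n \<or> n \<epsilon> m"
    using assms(2)
  proof (induction rule: om_induct)
    case definable
    show ?case by (intro dfn)
  next
    case emp
    then show ?case using zero by blast
  next
    case (suc n)
    then show ?case using suc_mem_suc by fastforce
  qed
  then show ?thesis using assms(1) by blast
qed

lemma fin_emp [simp]: "fin emp"
proof -
  have "is_bijection emp emp emp" by (simp add: is_bijection_def is_map_def)
  then show ?thesis using emp_om unfolding fin_def eqp_def by blast
qed

text \<open>A new element is sent to \<open>n\<close>, the number not yet used by a bijection onto
  \<open>n\<close>.\<close>

lemma fin_adj [simp]:
  assumes "fin F" shows "fin (adj F x)"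
proof (cases "x \<epsilon> F")
  case True
  then have "adj F x = F" by (auto simp: ext_iff[of "adj F x"])
  then show ?thesis using assms by simp
next
  case False
  obtain n f where n: "n \<epsilon> om" and f: "is_bijection f F n"
    using assms by (auto simp: fin_def eqp_def)
  define g where "g = adj f (pr x n)"
  have g: "pr y z \<epsilon> g \<longleftrightarrow> pr y z \<epsilon> f \<or> y = x \<and> z = n" for y z
    by (auto simp: g_def)
  have map: "is_map f F n" and inj: "\<And>x y z. pr x z \<epsilon> f \<Longrightarrow> pr y z \<epsilon> f \<Longrightarrow> x = y"
    and surj: "\<And>z. z \<epsilon> n \<Longrightarrow> \<exists>y. pr y z \<epsilon> f"
    using f by (auto simp: is_bijection_def)
  have dom: "\<not> pr x z \<epsilon> f" "\<not> pr y n \<epsilon> f" for y z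
    using map is_map_ap[OF map, of y] False by (auto simp: is_map_mem[OF map])
  have total: "\<exists>z. pr y z \<epsilon> f" if "y \<epsilon> F" for y
    using map that by (simp add: is_map_def)
  have functional: "z = z'" if "pr y z \<epsilon> f" "pr y z' \<epsilon> f" for y z z'
    using that by (simp add: is_map_mem[OF map])
  have "\<exists>y z. y \<epsilon> adj F x \<and> z \<epsilon> suc n \<and> p = pr y z" if "p \<epsilon> g" for p
  proof (cases "p \<epsilon> f")
    case True
    then show ?thesis using map unfolding is_map_def mem_adj by blast
  next
    case False
    then show ?thesis using that by (auto simp: g_def)
  qed
  moreover have "\<exists>z. pr y z \<epsilon> g" if "y \<epsilon> adj F x" for y
    using that total unfolding g mem_adj by blast
  moreover have "z = z'" if "pr y z \<epsilon> g" "pr y z' \<epsilon> g" for y z z'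
    using that dom functional unfolding g by blast
  ultimately have "is_map g (adj F x) (suc n)"
    unfolding is_map_def by blast
  moreover have "y = y'" if "pr y z \<epsilon> g" "pr y' z \<epsilon> g" for y y' z
    using that dom inj unfolding g by blast
  moreover have "\<exists>y. pr y z \<epsilon> g" if "z \<epsilon> suc n" for z
    using that surj unfolding g mem_adj by blast
  ultimately have "is_bijection g (adj F x) (suc n)"
    unfolding is_bijection_def by blast
  then show ?thesis using n unfolding fin_def eqp_def by (meson suc_om)
qed

lemma adj_diff: "x \<epsilon> F \<Longrightarrow> adj (diff F (upair x x)) x = F"
  by (auto simp: ext_iff[of _ F])

text \<open>Induction on the size: from a set with \<open>suc n\<close> elements the preimage of the
  number \<open>n\<close> is removed.\<close>

lemma fin_induct [consumes 1, case_names definable emp adj]: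
  assumes "fin F" and P: "definable (\<lambda>e. P (e 0))"
    and emp: "P emp" and adj: "\<And>F x. fin F \<Longrightarrow> P F \<Longrightarrow> \<not> x \<epsilon> F \<Longrightarrow> P (adj F x)"
  shows "P F"
proof -
  obtain n where n: "n \<epsilon> om" "eqp F n" using assms(1) by (auto simp: fin_def)
  have P': "definable (\<lambda>e. P (e i))" for i
    using definable_ren[OF P, of "\<lambda>_. i"] .
  have "\<forall>F. eqp F n \<longrightarrow> P F"
    using n(1)
  proof (induction rule: om_induct)
    case definable
    show ?case by (intro dfn P')
  next
    case emp
    have "F = emp" if "eqp F emp" for F
      using that by (auto simp: eqp_def is_bijection_def is_map_def emp_iff)
    then show ?case using assms(3) by blast
  next
    case (suc n)
    show ?case
    proof (intro allI impI)
      fix F assume "eqp F (suc n)"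
      then obtain f where f: "is_bijection f F (suc n)" by (auto simp: eqp_def)
      then obtain x where x: "x \<epsilon> F" "f \<cdot> x = n" by (auto simp: is_bijection_iff)
      let ?F = "diff F (upair x x)"
      have "eqp ?F n"
      proof (rule eqpI[of "\<lambda>y. f \<cdot> y"])
        show "tdef (\<lambda>e. f \<cdot> e 0)" by (intro dfn)
      next
        fix y assume y: "y \<epsilon> ?F"
        then have "f \<cdot> y \<epsilon> suc n" using f is_map_ap[of f F "suc n" y] by (simp add: is_bijection_iff)
        moreover have "f \<cdot> y \<noteq> n" using f x y by (auto simp: is_bijection_iff)
        ultimately show "f \<cdot> y \<epsilon> n" by simp
      next
        fix y z assume "y \<epsilon> ?F" "z \<epsilon> ?F" "f \<cdot> y = f \<cdot> z"
        then show "y = z" using f by (simp add: is_bijection_iff)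
      next
        fix y assume "y \<epsilon> n"
        then obtain z where "z \<epsilon> F" "f \<cdot> z = y" using f by (auto simp: is_bijection_iff)
        then show "\<exists>z. z \<epsilon> ?F \<and> f \<cdot> z = y" using x \<open>y \<epsilon> n\<close> by (intro exI[of _ z]) auto
      qed
      moreover have "fin ?F" using \<open>eqp ?F n\<close> suc.hyps by (auto simp: fin_def)
      ultimately have "P (adj ?F x)" using suc.IH by (intro adj) auto
      then show "P F" using x(1) by (simp add: adj_diff)
    qed
  qed
  then show ?thesis using n(2) by blast
qed

lemma fin_sub:
  assumes "fin F" and "G \<sqsubseteq> F" shows "fin G"
proof -
  have "\<forall>G. G \<sqsubseteq> F \<longrightarrow> fin G"
    using assms(1)
  proof (induction rule: fin_induct)
    case definable
    show ?case by (intro dfn)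
  next
    case emp
    have "G = emp" if "G \<sqsubseteq> emp" for G using that by (simp add: sub_def emp_iff)
    then show ?case using fin_emp by blast
  next
    case (adj F x)
    show ?case
    proof (intro allI impI)
      fix G assume G: "G \<sqsubseteq> adj F x"
      then have "diff G (upair x x) \<sqsubseteq> F" by (auto simp: sub_def)
      then have *: "fin (diff G (upair x x))" using adj.IH by blast
      show "fin G"
      proof (cases "x \<epsilon> G")
        case True
        then show ?thesis using fin_adj[OF *, of x] by (simp add: adj_diff)
      next
        case False
        then have "diff G (upair x x) = G" by (auto simp: ext_iff[of _ G])
        then show ?thesis using * by simp
      qed
    qed
  qed
  then show ?thesis using assms(2) by blast
qed

lemma fin_cup:
  assumes "fin F" and "fin G" shows "fin (cup F G)"
  using assms(1)
proof (induction rule: fin_induct)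
  case definable
  show ?case by (intro dfn)
next
  case emp
  have "cup emp G = G" by (simp add: ext_iff[of _ G])
  then show ?case using assms(2) by simp
next
  case (adj F x)
  have "cup (adj F x) G = adj (cup F G) x" by (auto simp: ext_iff[of "cup _ G"])
  then show ?case using adj.IH by simp
qed

lemma fin_img:
  assumes "fin F" and t: "tdef (\<lambda>e. t (e 0))" shows "fin (img F t)"
  using assms(1)
proof (induction rule: fin_induct)
  case definable
  have "tdef (\<lambda>e. t (e i))" for i
    using tdef_ren[OF t, of "\<lambda>_. i"] .
  then show ?case by (intro dfn)
next
  case emp
  have "img emp t = emp" by (simp add: emp_iff mem_img[OF t])
  then show ?case by simp
next
  case (adj F x)
  have "img (adj F x) t = adj (img F t) (t x)"
    by (auto simp: ext_iff[of "img _ t"] mem_img[OF t])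
  then show ?case using adj.IH by simp
qed

lemma fin_pow:
  assumes "fin F" shows "fin (pow F)"
  using assms
proof (induction rule: fin_induct)
  case definable
  show ?case by (intro dfn)
next
  case emp
  have "pow emp = adj emp emp"
    by (auto simp: ext_iff[of "pow _"] sub_def emp_iff)
  then show ?case by simp
next
  case (adj F x)
  have t: "tdef (\<lambda>e. adj (e 0) x)" by (intro dfn)
  \<comment> \<open>A subset of \<open>adj F x\<close> either avoids \<open>x\<close> or arises from
    a subset of \<open>F\<close> by adding \<open>x\<close>.\<close>
  have "pow (adj F x) \<sqsubseteq> cup (pow F) (img (pow F) (\<lambda>G. adj G x))"
    unfolding sub_def[of "pow _"]
  proof (intro allI impI)
    fix G assume "G \<epsilon> pow (adj F x)"
    then have G: "G \<sqsubseteq> adj F x" by simp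
    show "G \<epsilon> cup (pow F) (img (pow F) (\<lambda>G. adj G x))"
    proof (cases "x \<epsilon> G")
      case True
      have "diff G (upair x x) \<sqsubseteq> F" using G by (auto simp: sub_def)
      then show ?thesis using adj_diff[OF True] by (auto simp: mem_img[OF t] intro!: exI[of _ "diff G (upair x x)"])
    next
      case False
      then have "G \<sqsubseteq> F" using G by (auto simp: sub_def)
      then show ?thesis by simp
    qed
  qed
  moreover have "fin (cup (pow F) (img (pow F) (\<lambda>G. adj G x)))"
    using adj.IH t by (intro fin_cup fin_img)
  ultimately show ?case by (rule fin_sub[rotated])
qed

text \<open>In the induction step the value \<open>x\<close> of \<open>f\<close> is rerouted to \<open>f \<cdot> x\<close>.\<close>

lemma fin_inj_surj:
  assumes "fin F" and "\<And>z. z \<epsilon> F \<Longrightarrow> f \<cdot> z \<epsilon> F"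
    and "\<And>y z. y \<epsilon> F \<Longrightarrow> z \<epsilon> F \<Longrightarrow> f \<cdot> y = f \<cdot> z \<Longrightarrow> y = z" and "y \<epsilon> F"
  shows "\<exists>z. z \<epsilon> F \<and> f \<cdot> z = y"
proof -
  \<comment> \<open>\<open>f\<close> is quantified inside the induction, since the hypothesis is
    applied to the rerouted map, realised in the model as \<open>lam F t\<close>.\<close>
  have "\<forall>f. (\<forall>z. z \<epsilon> F \<longrightarrow> f \<cdot> z \<epsilon> F) \<and>
      (\<forall>y z. y \<epsilon> F \<longrightarrow> z \<epsilon> F \<longrightarrow> f \<cdot> y = f \<cdot> z \<longrightarrow> y = z) \<longrightarrow>
      (\<forall>y. y \<epsilon> F \<longrightarrow> (\<exists>z. z \<epsilon> F \<and> f \<cdot> z = y))"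
    using assms(1)
  proof (induction rule: fin_induct)
    case definable
    show ?case by (intro dfn)
  next
    case (adj F x)
    show ?case
    proof (intro allI impI)
      fix f y
      assume "(\<forall>z. z \<epsilon> adj F x \<longrightarrow> f \<cdot> z \<epsilon> adj F x) \<and>
        (\<forall>y z. y \<epsilon> adj F x \<longrightarrow> z \<epsilon> adj F x \<longrightarrow> f \<cdot> y = f \<cdot> z \<longrightarrow> y = z)"
      then have f: "\<And>z. z \<epsilon> adj F x \<Longrightarrow> f \<cdot> z \<epsilon> adj F x"
        and inj: "\<And>y z. y \<epsilon> adj F x \<Longrightarrow> z \<epsilon> adj F x \<Longrightarrow> f \<cdot> y = f \<cdot> z \<Longrightarrow> y = z"
        by blast+
      assume y: "y \<epsilon> adj F x"
      define t where "t z = (if f \<cdot> z = x then f \<cdot> x else f \<cdot> z)" for z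
      have t: "tdef (\<lambda>e. t (e 0))" unfolding t_def by (intro dfn)
      have tF: "t z \<epsilon> F" if "z \<epsilon> F" for z
        using f[of z] f[of x] inj[of z x] that adj.hyps(2) by (auto simp: t_def)
      have t_inj: "y = z" if "y \<epsilon> F" "z \<epsilon> F" "t y = t z" for y z
      proof -
        have mem: "y \<epsilon> adj F x" "z \<epsilon> adj F x" "x \<epsilon> adj F x" and "y \<noteq> x" "z \<noteq> x"
          using that adj.hyps(2) by auto
        then have "f \<cdot> y \<noteq> f \<cdot> x" "f \<cdot> z \<noteq> f \<cdot> x" using inj by blast+
        then have "f \<cdot> y = f \<cdot> z" using that(3) by (simp add: t_def split: if_splits)
        then show ?thesis using mem inj by blast
      qed
      have lam_t: "lam F t \<cdot> z = t z" if "z \<epsilon> F" for z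
        using ap_lam[OF t that] .
      have "(\<forall>z. z \<epsilon> F \<longrightarrow> lam F t \<cdot> z \<epsilon> F) \<and>
          (\<forall>y z. y \<epsilon> F \<longrightarrow> z \<epsilon> F \<longrightarrow> lam F t \<cdot> y = lam F t \<cdot> z \<longrightarrow> y = z)"
        using tF t_inj by (simp add: lam_t)
      then have "\<exists>z. z \<epsilon> F \<and> lam F t \<cdot> z = y" if "y \<epsilon> F" for y
        using adj.IH that by blast
      then have surj: "\<exists>z. z \<epsilon> F \<and> t z = y" if "y \<epsilon> F" for y
        using that lam_t by metis
      show "\<exists>z. z \<epsilon> adj F x \<and> f \<cdot> z = y"
      proof (cases "y = x")
        case False
        then show ?thesis using y surj[of y] by (auto simp: t_def split: if_splits)
      next
        case True
        show ?thesis
        proof (rule ccontr)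
          \<comment> \<open>If \<open>x\<close> is missed, nothing in \<open>F\<close> is rerouted,
            so surjectivity on \<open>F\<close> gives a second preimage of
            \<open>f \<cdot> x\<close>.\<close>
          assume no: "\<not> ?thesis"
          then have "t z = f \<cdot> z" if "z \<epsilon> F" for z using that True by (auto simp: t_def)
          moreover have "f \<cdot> x \<epsilon> F" using f[of x] no True by auto
          ultimately obtain z where "z \<epsilon> F" "f \<cdot> z = f \<cdot> x" using surj by metis
          then show False using inj[of z x] adj.hyps(2) by auto
        qed
      qed
    qed
  qed simp
  then show ?thesis using assms(2-4) by blast
qed

subsection \<open>Iteration and Dedekind-infinite sets\<close>

lemma suc_inject:
  assumes "m \<epsilon> om" "n \<epsilon> om" "suc m = suc n" shows "m = n"
proof (rule ccontr)
  assume "m \<noteq> n"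
  moreover have "m \<epsilon> suc n" "n \<epsilon> suc m" using assms(3)[symmetric] by (metis mem_adj, metis mem_adj assms(3))
  ultimately have "m \<epsilon> n" "n \<epsilon> m" by auto
  then have "m \<epsilon> m" using om_transitive[OF assms(1)] unfolding sub_def by blast
  then show False by simp
qed

text \<open>Recursion theorem. \<open>f\<close> is the least relation containing the initial pair
  and closed under the step; a surplus pair could be removed without destroying closure, so
  \<open>f\<close> is single-valued.\<close>

lemma iteration:
  assumes s: "s \<epsilon> S" and h: "\<And>x. x \<epsilon> S \<Longrightarrow> h \<cdot> x \<epsilon> S"
  shows "\<exists>f. is_map f om S \<and> f \<cdot> emp = s \<and> (\<forall>n. n \<epsilon> om \<longrightarrow> f \<cdot> suc n = h \<cdot> (f \<cdot> n))"
proof -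
  define closed where "closed R \<longleftrightarrow> pr emp s \<epsilon> R \<and>
      (\<forall>n x. n \<epsilon> om \<longrightarrow> x \<epsilon> S \<longrightarrow> pr n x \<epsilon> R \<longrightarrow> pr (suc n) (h \<cdot> x) \<epsilon> R)" for R
  have closed_dfn: "definable (\<lambda>e. closed (e i))" for i
    unfolding closed_def by (intro dfn)
  define f where "f = sep (prd om S) (\<lambda>p. \<forall>R. closed R \<longrightarrow> p \<epsilon> R)"
  have f: "p \<epsilon> f \<longleftrightarrow> p \<epsilon> prd om S \<and> (\<forall>R. closed R \<longrightarrow> p \<epsilon> R)" for p
    unfolding f_def by (rule mem_sep) (intro dfn closed_dfn)
  have f_zero: "pr emp s \<epsilon> f"
    using s by (auto simp: f closed_def)
  have f_suc: "pr (suc n) (h \<cdot> x) \<epsilon> f" if "pr n x \<epsilon> f" for n x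
    using that h by (auto simp: f) (auto simp: closed_def)
  have remove: "\<not> closed (diff f (upair p p))" if "p \<epsilon> f" for p
    using that f by (metis mem_diff mem_upair)
  have uniq_zero: "x = s" if "pr emp x \<epsilon> f" for x
  proof (rule ccontr)
    assume "x \<noteq> s"
    moreover have "suc n \<noteq> emp" for n by (auto simp: emp_iff)
    ultimately have "closed (diff f (upair (pr emp x) (pr emp x)))"
      using f_zero f_suc by (auto simp: closed_def)
    then show False using remove that by blast
  qed
  have uniq_suc: "y = h \<cdot> x" if "n \<epsilon> om" "pr n x \<epsilon> f" "\<And>z. pr n z \<epsilon> f \<Longrightarrow> z = x" "pr (suc n) y \<epsilon> f"
    for n x y
  proof (rule ccontr)
    assume "y \<noteq> h \<cdot> x"
    then have "pr (suc m) (h \<cdot> z) \<noteq> pr (suc n) y" if "m \<epsilon> om" "pr m z \<epsilon> f" for m z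
      using suc_inject[OF that(1) \<open>n \<epsilon> om\<close>] that(2) \<open>\<And>z. pr n z \<epsilon> f \<Longrightarrow> z = x\<close>
      unfolding pr_inject by metis
    moreover have "suc n \<noteq> emp" by (auto simp: emp_iff)
    ultimately have "closed (diff f (upair (pr (suc n) y) (pr (suc n) y)))"
      using f_zero f_suc unfolding closed_def mem_diff mem_upair by (metis pr_inject)
    then show False using remove that(4) by blast
  qed
  have ex1: "\<exists>x. pr n x \<epsilon> f \<and> (\<forall>y. pr n y \<epsilon> f \<longrightarrow> y = x)" if "n \<epsilon> om" for n
    using that
  proof (induction rule: om_induct)
    case definable
    show ?case by (intro dfn)
  next
    case emp
    then show ?case using f_zero uniq_zero by blast
  next
    case (suc n)
    then show ?case using f_suc uniq_suc by meson
  qed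
  have map: "is_map f om S"
    unfolding is_map_def
  proof (intro conjI allI impI)
    fix p assume "p \<epsilon> f"
    then show "\<exists>x y. x \<epsilon> om \<and> y \<epsilon> S \<and> p = pr x y" by (simp add: f mem_prd)
  next
    fix n assume "n \<epsilon> om"
    then show "\<exists>x. pr n x \<epsilon> f" using ex1 by blast
  next
    fix n x y assume xy: "pr n x \<epsilon> f \<and> pr n y \<epsilon> f"
    then have "n \<epsilon> om" by (auto simp: f)
    then show "x = y" using ex1 xy by metis
  qed
  have "f \<cdot> emp = s" using f_zero by (simp add: is_map_mem[OF map])
  moreover have "f \<cdot> suc n = h \<cdot> (f \<cdot> n)" if "n \<epsilon> om" for n
    using f_suc[of n "f \<cdot> n"] that by (simp add: is_map_mem[OF map])
  ultimately show ?thesis using map by blast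
qed

definition dedekind_inf :: "'a \<Rightarrow> bool" where
  "dedekind_inf X \<longleftrightarrow> (\<exists>Y. Y \<sqsubseteq> X \<and> Y \<noteq> X \<and> eqp X Y)"

lemma tdef_ap_const: "tdef (\<lambda>e. f \<cdot> e i)"
  by (intro dfn)

text \<open>The sequence is the orbit under \<open>h\<close> of a point \<open>s\<close> outside the
  range of \<open>h\<close>. The map \<open>h\<close> sends the orbit injectively into itself and
  misses \<open>s\<close>, so the orbit is infinite by \<open>fin_inj_surj\<close>.\<close>

lemma dedekind_inf_sequence:
  assumes "dedekind_inf S"
  shows "\<exists>f. is_map f om S \<and> \<not> fin (img om (\<lambda>n. f \<cdot> n))"
proof -
  obtain Y h where Y: "Y \<sqsubseteq> S" "Y \<noteq> S" and h: "is_bijection h S Y"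
    using assms by (auto simp: dedekind_inf_def eqp_def)
  then obtain s where s: "s \<epsilon> S" "\<not> s \<epsilon> Y" by (metis sub_antisym sub_def)
  have h': "h \<cdot> x \<epsilon> Y" if "x \<epsilon> S" for x
    using h is_map_ap that by (auto simp: is_bijection_iff)
  moreover have "h \<cdot> x \<epsilon> S" if "x \<epsilon> S" for x
    using h'[OF that] Y(1) by (simp add: sub_def)
  ultimately obtain f where f: "is_map f om S" "f \<cdot> emp = s" "\<And>n. n \<epsilon> om \<Longrightarrow> f \<cdot> suc n = h \<cdot> (f \<cdot> n)"
    using iteration[OF s(1)] by blast
  let ?K = "img om (\<lambda>n. f \<cdot> n)"
  have K: "x \<epsilon> ?K \<longleftrightarrow> (\<exists>n. n \<epsilon> om \<and> x = f \<cdot> n)" for x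
    by (rule mem_img) (rule tdef_ap_const)
  have K_S: "x \<epsilon> S" if "x \<epsilon> ?K" for x
    using that is_map_ap[OF f(1)] by (auto simp: K)
  have "\<not> fin ?K"
  proof
    assume "fin ?K"
    then have "\<exists>z. z \<epsilon> ?K \<and> h \<cdot> z = s"
    proof (rule fin_inj_surj)
      fix z assume "z \<epsilon> ?K"
      then show "h \<cdot> z \<epsilon> ?K" unfolding K using f(3) suc_om by metis
    next
      fix y z assume "y \<epsilon> ?K" "z \<epsilon> ?K" "h \<cdot> y = h \<cdot> z"
      then show "y = z" using h K_S by (auto simp: is_bijection_iff)
    next
      show "s \<epsilon> ?K" unfolding K using f(2) emp_om by metis
    qed
    then show False using h' K_S s(2) by metis
  qed
  then show ?thesis using f(1) by blast
qed

subsection \<open>P-spaces\<close>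

definition topology :: "'a \<Rightarrow> 'a \<Rightarrow> bool" where
  "topology X T \<longleftrightarrow> (\<forall>U. U \<epsilon> T \<longrightarrow> U \<sqsubseteq> X) \<and> emp \<epsilon> T \<and> X \<epsilon> T \<and>
     (\<forall>U V. U \<epsilon> T \<and> V \<epsilon> T \<longrightarrow> (\<forall>W. (\<forall>z. z \<epsilon> W \<longleftrightarrow> z \<epsilon> U \<and> z \<epsilon> V) \<longrightarrow> W \<epsilon> T)) \<and>
     (\<forall>S. S \<sqsubseteq> T \<longrightarrow> (\<forall>W. (\<forall>z. z \<epsilon> W \<longleftrightarrow> (\<exists>U. U \<epsilon> S \<and> z \<epsilon> U)) \<longrightarrow> W \<epsilon> T))"

definition Gdelta :: "'a \<Rightarrow> 'a \<Rightarrow> 'a \<Rightarrow> bool" where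
  "Gdelta G X T \<longleftrightarrow>
     (\<exists>f. is_map f om T \<and> (\<forall>z. z \<epsilon> G \<longleftrightarrow> z \<epsilon> X \<and> (\<forall>n. n \<epsilon> om \<longrightarrow> z \<epsilon> f \<cdot> n)))"

definition P_space :: "'a \<Rightarrow> 'a \<Rightarrow> bool" where
  "P_space X T \<longleftrightarrow> topology X T \<and> (\<forall>G. Gdelta G X T \<longrightarrow> G \<epsilon> T)"

definition cofinite_top :: "'a \<Rightarrow> 'a \<Rightarrow> bool" where
  "cofinite_top X T \<longleftrightarrow> (\<forall>U. U \<epsilon> T \<longleftrightarrow> U = emp \<or> (\<exists>F. F \<sqsubseteq> X \<and> fin F \<and> U = diff X F))"

definition infty_space :: "'a \<Rightarrow> 'a \<Rightarrow> 'a \<Rightarrow> 'a \<Rightarrow> bool" where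
  "infty_space Y T X p \<longleftrightarrow> Y = adj X p \<and>
     (\<forall>U. U \<epsilon> T \<longleftrightarrow> U \<sqsubseteq> X \<or> (\<exists>F. F \<sqsubseteq> X \<and> fin F \<and> U = diff Y F))"

definition quasi_dedekind_inf :: "'a \<Rightarrow> bool" where
  "quasi_dedekind_inf X \<longleftrightarrow> (\<exists>S. (\<forall>F. F \<epsilon> S \<longleftrightarrow> F \<sqsubseteq> X \<and> fin F) \<and> dedekind_inf S)"

lemma diff_diff: "F \<sqsubseteq> X \<Longrightarrow> diff X (diff X F) = F"
  by (auto simp: sub_def ext_iff[of _ F])

lemma diff_sub [simp]: "diff X F \<sqsubseteq> X"
  by (simp add: sub_def)

lemma sub_adj [simp]: "X \<sqsubseteq> adj X p"
  by (simp add: sub_def)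

lemma cofinite_top_iff:
  "cofinite_top X T \<longleftrightarrow> (\<forall>U. U \<epsilon> T \<longleftrightarrow> U = emp \<or> U \<sqsubseteq> X \<and> fin (diff X U))"
  unfolding cofinite_top_def by (metis diff_diff diff_sub)

text \<open>The two kinds of open sets merge into one condition: only sets containing
  \<open>p\<close> have to be cofinite.\<close>

lemma infty_space_iff:
  assumes "\<not> p \<epsilon> X"
  shows "infty_space Y T X p \<longleftrightarrow> Y = adj X p \<and>
     (\<forall>U. U \<epsilon> T \<longleftrightarrow> U \<sqsubseteq> Y \<and> (p \<epsilon> U \<longrightarrow> fin (diff Y U)))"
proof -
  have "U \<sqsubseteq> X \<or> (\<exists>F. F \<sqsubseteq> X \<and> fin F \<and> U = diff Y F) \<longleftrightarrow> U \<sqsubseteq> Y \<and> (p \<epsilon> U \<longrightarrow> fin (diff Y U))"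
    if Y: "Y = adj X p" for U
  proof (cases "p \<epsilon> U")
    case False
    then show ?thesis using assms by (auto simp: Y sub_def)
  next
    case True
    then have "\<not> U \<sqsubseteq> X" using assms by (auto simp: sub_def)
    moreover have "U \<sqsubseteq> Y \<and> fin (diff Y U)" if "F \<sqsubseteq> X" "fin F" "U = diff Y F" for F
      using that diff_diff[of F Y] sub_trans[OF that(1), of Y] by (simp add: Y)
    moreover have "diff Y U \<sqsubseteq> X" using True by (auto simp: Y sub_def)
    ultimately show ?thesis using True diff_diff[of U Y] by metis
  qed
  then show ?thesis unfolding infty_space_def by auto
qed

lemma cofinite_top_topology:
  assumes "cofinite_top X T" shows "topology X T"
proof -
  have T: "U \<epsilon> T \<longleftrightarrow> U = emp \<or> U \<sqsubseteq> X \<and> fin (diff X U)" for U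
    using assms by (simp add: cofinite_top_iff)
  have "U \<sqsubseteq> X" if "U \<epsilon> T" for U using that by (auto simp: T)
  moreover have "emp \<epsilon> T" by (simp add: T)
  moreover have "diff X X = emp" by (simp add: emp_iff)
  then have "X \<epsilon> T" by (simp add: T)
  moreover have "W \<epsilon> T" if "U \<epsilon> T" "V \<epsilon> T" and W: "\<forall>z. z \<epsilon> W \<longleftrightarrow> z \<epsilon> U \<and> z \<epsilon> V" for U V W
  proof (cases "U = emp \<or> V = emp")
    case True
    then have "W = emp" using W by (auto simp: emp_iff)
    then show ?thesis by (simp add: T)
  next
    case False
    then have UV: "U \<sqsubseteq> X" "fin (diff X U)" "fin (diff X V)" using that by (auto simp: T)
    have "diff X W = cup (diff X U) (diff X V)" using W by (auto simp: ext_iff[of "diff X W"])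
    then have "fin (diff X W)" using UV fin_cup by simp
    moreover have "W \<sqsubseteq> X" using UV W by (simp add: sub_def)
    ultimately show ?thesis by (simp add: T)
  qed
  moreover have "W \<epsilon> T" if "S \<sqsubseteq> T" and W: "\<forall>z. z \<epsilon> W \<longleftrightarrow> (\<exists>U. U \<epsilon> S \<and> z \<epsilon> U)" for S W
  proof (cases "W = emp")
    case False
    then obtain U z where U: "U \<epsilon> S" "z \<epsilon> U" using W by (auto simp: emp_iff)
    then have "fin (diff X U)" using that(1) T[of U] by (auto simp: sub_def)
    moreover have "diff X W \<sqsubseteq> diff X U" using U(1) W by (auto simp: sub_def)
    moreover have "W \<sqsubseteq> X" using W that(1) T unfolding sub_def by (metis mem_emp)
    ultimately show ?thesis using fin_sub by (auto simp: T)
  qed (simp add: T)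
  ultimately show ?thesis unfolding topology_def by blast
qed

lemma infty_space_topology:
  assumes "infty_space Y T X p" and "\<not> p \<epsilon> X" shows "topology Y T"
proof -
  have T: "U \<epsilon> T \<longleftrightarrow> U \<sqsubseteq> Y \<and> (p \<epsilon> U \<longrightarrow> fin (diff Y U))" for U
    using assms by (simp add: infty_space_iff)
  have "U \<sqsubseteq> Y" if "U \<epsilon> T" for U using that by (auto simp: T)
  moreover have "emp \<epsilon> T" by (simp add: T)
  moreover have "diff Y Y = emp" by (simp add: emp_iff)
  then have "Y \<epsilon> T" by (simp add: T)
  moreover have "W \<epsilon> T" if "U \<epsilon> T" "V \<epsilon> T" and W: "\<forall>z. z \<epsilon> W \<longleftrightarrow> z \<epsilon> U \<and> z \<epsilon> V" for U V W
  proof -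
    have "diff Y W = cup (diff Y U) (diff Y V)" using W by (auto simp: ext_iff[of "diff Y W"])
    then have "p \<epsilon> W \<longrightarrow> fin (diff Y W)" using that fin_cup by (simp add: T)
    moreover have "W \<sqsubseteq> Y" using that by (simp add: T sub_def)
    ultimately show ?thesis by (simp add: T)
  qed
  moreover have "W \<epsilon> T" if "S \<sqsubseteq> T" and W: "\<forall>z. z \<epsilon> W \<longleftrightarrow> (\<exists>U. U \<epsilon> S \<and> z \<epsilon> U)" for S W
  proof -
    have "fin (diff Y W)" if "p \<epsilon> W"
    proof -
      obtain U where U: "U \<epsilon> S" "p \<epsilon> U" using W \<open>p \<epsilon> W\<close> by blast
      then have "fin (diff Y U)" using \<open>S \<sqsubseteq> T\<close> T[of U] by (auto simp: sub_def)
      moreover have "diff Y W \<sqsubseteq> diff Y U" using U(1) W by (auto simp: sub_def)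
      ultimately show ?thesis using fin_sub by blast
    qed
    moreover have "W \<sqsubseteq> Y" using W that(1) T unfolding sub_def by metis
    ultimately show ?thesis by (simp add: T)
  qed
  ultimately show ?thesis unfolding topology_def by blast
qed

lemma cofinite_not_P_space:
  assumes "\<not> fin X" and "quasi_dedekind_inf X"
  shows "\<exists>T. cofinite_top X T \<and> \<not> P_space X T"
proof -
  obtain S where S: "\<And>F. F \<epsilon> S \<longleftrightarrow> F \<sqsubseteq> X \<and> fin F" "dedekind_inf S"
    using assms(2) by (auto simp: quasi_dedekind_inf_def)
  obtain f where f: "is_map f om S" and inf: "\<not> fin (img om (\<lambda>n. f \<cdot> n))"
    using dedekind_inf_sequence[OF S(2)] by blast
  have fn: "f \<cdot> n \<sqsubseteq> X \<and> fin (f \<cdot> n)" if "n \<epsilon> om" for n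
    using is_map_ap[OF f that] by (simp add: S)
  have "\<not> X = emp" using assms(1) fin_emp by blast
  then obtain x where x: "x \<epsilon> X" by (auto simp: emp_iff)
  define T where "T = sep (pow X) (\<lambda>U. U = emp \<or> fin (diff X U))"
  have "definable (\<lambda>e. e 0 = emp \<or> fin (diff X (e 0)))" by (intro dfn)
  then have T: "U \<epsilon> T \<longleftrightarrow> U = emp \<or> U \<sqsubseteq> X \<and> fin (diff X U)" for U
    by (auto simp: T_def mem_sep)
  define U where "U = Uni (img om (\<lambda>n. f \<cdot> n))"
  have U: "z \<epsilon> U \<longleftrightarrow> (\<exists>n. n \<epsilon> om \<and> z \<epsilon> f \<cdot> n)" for z
    by (auto simp: U_def mem_img[OF tdef_ap_const])
  \<comment> \<open>A finite union would place all values of the sequence in its finite power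
    set.\<close>
  have "\<not> fin U"
  proof
    assume "fin U"
    then have "fin (pow U)" by (rule fin_pow)
    moreover have "img om (\<lambda>n. f \<cdot> n) \<sqsubseteq> pow U"
      by (auto simp: sub_def[of _ "pow U"] mem_img[OF tdef_ap_const]) (auto simp: sub_def U)
    ultimately show False using inf fin_sub by blast
  qed
  \<comment> \<open>\<open>x\<close> keeps \<open>G\<close> nonempty, so that \<open>G\<close> can
    only be open by being cofinite.\<close>
  define G where "G = adj (diff X U) x"
  have "Gdelta G X T"
    unfolding Gdelta_def
  proof (intro exI conjI allI)
    let ?t = "\<lambda>n. adj (diff X (f \<cdot> n)) x"
    have t: "tdef (\<lambda>e. ?t (e 0))" by (intro dfn)
    show "is_map (lam om ?t) om T"
    proof (rule is_map_lam[OF t])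
      fix n assume n: "n \<epsilon> om"
      have "diff X (?t n) \<sqsubseteq> f \<cdot> n" by (auto simp: sub_def)
      then have "fin (diff X (?t n))" using fn[OF n] fin_sub by blast
      moreover have "?t n \<sqsubseteq> X" using x by (auto simp: sub_def)
      ultimately show "?t n \<epsilon> T" by (simp add: T)
    qed
    show "z \<epsilon> G \<longleftrightarrow> z \<epsilon> X \<and> (\<forall>n. n \<epsilon> om \<longrightarrow> z \<epsilon> lam om ?t \<cdot> n)" for z
      using x emp_om by (auto simp: ap_lam[OF t] G_def U)
  qed
  moreover have "\<not> G \<epsilon> T"
  proof
    assume "G \<epsilon> T"
    moreover have "G \<noteq> emp" by (auto simp: emp_iff G_def)
    ultimately have "fin (adj (diff X G) x)" by (simp add: T)
    \<comment> \<open>The complement of \<open>G\<close> covers \<open>U\<close> only up to the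
      point \<open>x\<close>.\<close>
    moreover have "U \<sqsubseteq> adj (diff X G) x"
      using fn by (auto simp: sub_def U G_def)
    ultimately show False using \<open>\<not> fin U\<close> fin_sub by blast
  qed
  ultimately have "\<not> P_space X T" by (auto simp: P_space_def)
  moreover have "cofinite_top X T" by (simp add: cofinite_top_iff T)
  ultimately show ?thesis by blast
qed

lemma infty_space_not_P_space:
  assumes T: "cofinite_top X T" and "\<not> P_space X T" and p: "\<not> p \<epsilon> X"
  shows "\<exists>Y T. infty_space Y T X p \<and> \<not> P_space Y T"
proof -
  obtain G f where f: "is_map f om T" and G: "\<And>z. z \<epsilon> G \<longleftrightarrow> z \<epsilon> X \<and> (\<forall>n. n \<epsilon> om \<longrightarrow> z \<epsilon> f \<cdot> n)"
    and GT: "\<not> G \<epsilon> T"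
    using assms(2) cofinite_top_topology[OF T] by (auto simp: P_space_def Gdelta_def)
  have T: "U \<epsilon> T \<longleftrightarrow> U = emp \<or> U \<sqsubseteq> X \<and> fin (diff X U)" for U
    using T by (simp add: cofinite_top_iff)
  \<comment> \<open>A point of \<open>G\<close> lies in every \<open>f \<cdot> n\<close>, which
    excludes the empty open set and makes all of them cofinite.\<close>
  obtain g where g: "g \<epsilon> G" using GT by (auto simp: T emp_iff)
  define Y where "Y = adj X p"
  define T' where "T' = sep (pow Y) (\<lambda>U. p \<epsilon> U \<longrightarrow> fin (diff Y U))"
  have "definable (\<lambda>e. p \<epsilon> e 0 \<longrightarrow> fin (diff Y (e 0)))" by (intro dfn)
  then have T': "U \<epsilon> T' \<longleftrightarrow> U \<sqsubseteq> Y \<and> (p \<epsilon> U \<longrightarrow> fin (diff Y U))" for U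
    by (auto simp: T'_def mem_sep)
  \<comment> \<open>Adding \<open>p\<close> to a set leaves its complement the same in the larger
    space, so finiteness of complements transfers in both directions.\<close>
  have diff_eq: "diff Y (adj U p) = diff X U" for U
    using p by (auto simp: Y_def ext_iff[of _ "diff X U"])
  have "Gdelta (adj G p) Y T'"
    unfolding Gdelta_def
  proof (intro exI conjI allI)
    let ?t = "\<lambda>n. adj (f \<cdot> n) p"
    have t: "tdef (\<lambda>e. ?t (e 0))" by (intro dfn)
    show "is_map (lam om ?t) om T'"
    proof (rule is_map_lam[OF t])
      fix n assume n: "n \<epsilon> om"
      have "f \<cdot> n \<noteq> emp" using n g by (auto simp: G emp_iff)
      then have "f \<cdot> n \<sqsubseteq> X" "fin (diff X (f \<cdot> n))" using is_map_ap[OF f n] by (auto simp: T)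
      then show "?t n \<epsilon> T'" by (simp add: T' diff_eq) (auto simp: sub_def Y_def)
    qed
    show "z \<epsilon> adj G p \<longleftrightarrow> z \<epsilon> Y \<and> (\<forall>n. n \<epsilon> om \<longrightarrow> z \<epsilon> lam om ?t \<cdot> n)" for z
      by (auto simp: ap_lam[OF t] G Y_def)
  qed
  moreover have "\<not> adj G p \<epsilon> T'"
  proof
    assume "adj G p \<epsilon> T'"
    then have "fin (diff X G)" by (simp add: T' diff_eq)
    moreover have "G \<sqsubseteq> X" by (simp add: sub_def G)
    ultimately show False using GT by (simp add: T)
  qed
  ultimately have "\<not> P_space Y T'" by (auto simp: P_space_def)
  moreover have "infty_space Y T' X p"
    by (simp add: infty_space_iff[OF p] T' Y_def)
  ultimately show ?thesis by blast
qed

text \<open>The injection sends each member of the chain to the next one and fixes all other sets.\<close>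

lemma dedekind_inf_chain:
  assumes S: "\<And>n. n \<epsilon> om \<Longrightarrow> H n \<epsilon> S" and H: "tdef (\<lambda>e. H (e 0))"
    and mono: "\<And>m n. n \<epsilon> om \<Longrightarrow> m \<epsilon> n \<Longrightarrow> H m \<sqsubseteq> H n"
    and next_ex: "\<And>m. m \<epsilon> om \<Longrightarrow> \<exists>n. n \<epsilon> om \<and> \<not> H n \<sqsubseteq> H m"
    and zero: "H emp = emp"
  shows "dedekind_inf S"
proof -
  have Hi: "tdef (\<lambda>e. H (e i))" for i
    using tdef_ren[OF H, of "\<lambda>_. i"] .
  define K where "K = img om H"
  have K: "A \<epsilon> K \<longleftrightarrow> (\<exists>n. n \<epsilon> om \<and> A = H n)" for A
    unfolding K_def by (rule mem_img[OF H])
  have chain: "A \<sqsubseteq> B \<or> B \<sqsubseteq> A" if "A \<epsilon> K" "B \<epsilon> K" for A B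
    using that unfolding K by (metis om_linear mono sub_refl)
  have least: "\<exists>B. B \<epsilon> K \<and> A \<sqsubseteq> B \<and> A \<noteq> B \<and> (\<forall>C. C \<epsilon> K \<and> A \<sqsubseteq> C \<and> A \<noteq> C \<longrightarrow> B \<sqsubseteq> C)"
    if A: "A \<epsilon> K" for A
  proof -
    \<comment> \<open>Indices of strictly larger members. A minimal index exists by foundation and
      is least by linearity, so monotonicity makes its member least.\<close>
    define N where "N = sep om (\<lambda>n. A \<sqsubseteq> H n \<and> A \<noteq> H n)"
    have "definable (\<lambda>e. A \<sqsubseteq> H (e 0) \<and> A \<noteq> H (e 0))" by (intro dfn Hi)
    then have N: "n \<epsilon> N \<longleftrightarrow> n \<epsilon> om \<and> A \<sqsubseteq> H n \<and> A \<noteq> H n" for n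
      unfolding N_def by (rule mem_sep)
    obtain n where "n \<epsilon> om" "\<not> H n \<sqsubseteq> A" using A next_ex by (auto simp: K)
    then have "n \<epsilon> N" using chain[OF A, of "H n"] by (auto simp: N K)
    then obtain m where m: "m \<epsilon> N" "\<And>k. k \<epsilon> N \<Longrightarrow> \<not> k \<epsilon> m"
      using foundation_ax by blast
    have "H m \<sqsubseteq> H k" if "k \<epsilon> N" for k
    proof -
      have "m \<epsilon> k \<or> m = k" "k \<epsilon> om" using om_linear[of m k] m that N by blast+
      then show ?thesis using mono[of k m] by auto
    qed
    moreover have "\<exists>k. k \<epsilon> N \<and> C = H k" if "C \<epsilon> K \<and> A \<sqsubseteq> C \<and> A \<noteq> C" for C
      using that unfolding K N by blast
    moreover have "H m \<epsilon> K" "A \<sqsubseteq> H m" "A \<noteq> H m"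
      using m(1) unfolding K N by blast+
    ultimately show ?thesis by metis
  qed
  \<comment> \<open>The next member is the intersection of all strictly larger members, which makes
    it definable without selecting an index; \<open>Uni K\<close> bounds the separation.\<close>
  define nxt where "nxt A = sep (Uni K) (\<lambda>z. \<forall>C. C \<epsilon> K \<and> A \<sqsubseteq> C \<and> A \<noteq> C \<longrightarrow> z \<epsilon> C)" for A
  have nxt_dfn: "tdef (\<lambda>e. nxt (e i))" for i
    unfolding nxt_def by (intro dfn)
  have mem_nxt: "z \<epsilon> nxt A \<longleftrightarrow> z \<epsilon> Uni K \<and> (\<forall>C. C \<epsilon> K \<and> A \<sqsubseteq> C \<and> A \<noteq> C \<longrightarrow> z \<epsilon> C)" for z A
    unfolding nxt_def by (rule mem_sep) (intro dfn)
  have nxt: "nxt A \<epsilon> K \<and> A \<sqsubseteq> nxt A \<and> A \<noteq> nxt A"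
    and nxt_least: "C \<epsilon> K \<Longrightarrow> A \<sqsubseteq> C \<Longrightarrow> A \<noteq> C \<Longrightarrow> nxt A \<sqsubseteq> C" if A: "A \<epsilon> K" for A C
  proof -
    obtain B where B: "B \<epsilon> K" "A \<sqsubseteq> B" "A \<noteq> B"
      and B': "\<And>C. C \<epsilon> K \<Longrightarrow> A \<sqsubseteq> C \<Longrightarrow> A \<noteq> C \<Longrightarrow> B \<sqsubseteq> C"
      using least[OF A] by blast
    have "z \<epsilon> nxt A \<longleftrightarrow> z \<epsilon> B" for z
      unfolding mem_nxt mem_Uni using B B' unfolding sub_def by blast
    then have "nxt A = B" by (simp add: ext_iff[of _ B])
    then show "nxt A \<epsilon> K \<and> A \<sqsubseteq> nxt A \<and> A \<noteq> nxt A"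
      and "C \<epsilon> K \<Longrightarrow> A \<sqsubseteq> C \<Longrightarrow> A \<noteq> C \<Longrightarrow> nxt A \<sqsubseteq> C"
      using B B' by auto
  qed
  have nxt_inj: "A = B" if AB: "A \<epsilon> K" "B \<epsilon> K" "nxt A = nxt B" for A B
  proof (rule ccontr)
    assume ne: "A \<noteq> B"
    \<comment> \<open>With \<open>A\<close> strictly below \<open>B\<close>, the set
      \<open>nxt A\<close> is below \<open>B\<close>, which is strictly below
      \<open>nxt B\<close>.\<close>
    have False if "A \<epsilon> K" "B \<epsilon> K" "nxt A = nxt B" "A \<noteq> B" "A \<sqsubseteq> B" for A B
      using that nxt[OF that(2)] nxt_least[OF that(1,2)] by (metis sub_antisym)
    then show False using AB ne chain by metis
  qed
  define g where "g A = (if A \<epsilon> K then nxt A else A)" for A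
  have g_dfn: "tdef (\<lambda>e. g (e 0))"
    unfolding g_def by (intro dfn nxt_dfn)
  have K_S: "A \<epsilon> S" if "A \<epsilon> K" for A
    using that S by (auto simp: K)
  \<comment> \<open>Values on \<open>K\<close> stay in \<open>K\<close>, so they never collide with
    a fixed set outside \<open>K\<close>.\<close>
  have g_inj: "A = B" if "g A = g B" for A B
    using that nxt nxt_inj by (auto simp: g_def split: if_splits)
  have g_S: "g A \<epsilon> S" if "A \<epsilon> S" for A
    using that nxt K_S by (auto simp: g_def)
  have "emp \<epsilon> K" using zero emp_om unfolding K by metis
  \<comment> \<open>As a member of \<open>K\<close> the empty set is moved, and a value of
    \<open>nxt\<close> on \<open>K\<close> is nonempty, being a proper superset.\<close>
  have g_emp: "g A \<noteq> emp" for A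
  proof
    assume "g A = emp"
    then have "A \<epsilon> K" using \<open>emp \<epsilon> K\<close> by (auto simp: g_def split: if_splits)
    then have "A \<sqsubseteq> emp" "A \<noteq> emp" using \<open>g A = emp\<close> nxt[of A] by (auto simp: g_def)
    then show False using sub_antisym emp_sub by blast
  qed
  have img: "B \<epsilon> img S g \<longleftrightarrow> (\<exists>A. A \<epsilon> S \<and> B = g A)" for B
    by (rule mem_img[OF g_dfn])
  have "eqp S (img S g)"
    by (rule eqpI[OF g_dfn]) (use g_inj in \<open>auto simp: img\<close>)
  moreover have "img S g \<sqsubseteq> S" using g_S by (auto simp: sub_def img)
  moreover have "\<not> emp \<epsilon> img S g" using g_emp by (metis img)
  then have "img S g \<noteq> S" using K_S[OF \<open>emp \<epsilon> K\<close>] by metis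
  ultimately show ?thesis unfolding dedekind_inf_def by blast
qed

lemma quasi_dedekind_inf_infty_space:
  assumes Y: "infty_space Y T X p" and "\<not> P_space Y T" and p: "\<not> p \<epsilon> X"
  shows "quasi_dedekind_inf X"
proof -
  obtain G f where f: "is_map f om T" and G: "\<And>z. z \<epsilon> G \<longleftrightarrow> z \<epsilon> Y \<and> (\<forall>n. n \<epsilon> om \<longrightarrow> z \<epsilon> f \<cdot> n)"
    and GT: "\<not> G \<epsilon> T"
    using assms(2) infty_space_topology[OF Y p] by (auto simp: P_space_def Gdelta_def)
  have YX: "Y = adj X p" and T: "\<And>U. U \<epsilon> T \<longleftrightarrow> U \<sqsubseteq> Y \<and> (p \<epsilon> U \<longrightarrow> fin (diff Y U))"
    using Y by (simp_all add: infty_space_iff[OF p])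
  have "G \<sqsubseteq> Y" by (simp add: sub_def G)
  \<comment> \<open>Subsets of \<open>Y\<close> without \<open>p\<close> are open, so
    \<open>G\<close> contains \<open>p\<close>; hence every \<open>f \<cdot> n\<close> contains
    \<open>p\<close> and has a finite complement.\<close>
  then have pG: "p \<epsilon> G" and inf: "\<not> fin (diff Y G)" using GT by (auto simp: T)
  have fn: "fin (diff Y (f \<cdot> n)) \<and> p \<epsilon> f \<cdot> n" if "n \<epsilon> om" for n
    using is_map_ap[OF f that] pG that by (simp add: T G)
  \<comment> \<open>The union of the complements with index below \<open>n\<close>, as a number is
    the set of its predecessors; \<open>emp\<close> gives the empty union.\<close>
  define H where "H n = Uni (img n (\<lambda>i. diff Y (f \<cdot> i)))" for n
  have H: "z \<epsilon> H n \<longleftrightarrow> (\<exists>i. i \<epsilon> n \<and> z \<epsilon> Y \<and> \<not> z \<epsilon> f \<cdot> i)" for z n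
  proof -
    have "tdef (\<lambda>e. diff Y (f \<cdot> e 0))" by (intro dfn)
    from mem_img[OF this] show ?thesis by (auto simp: H_def)
  qed
  have H_dfn: "tdef (\<lambda>e. H (e i))" for i
    unfolding H_def by (intro dfn)
  have H_fin: "fin (H n)" if "n \<epsilon> om" for n
    using that
  proof (induction rule: om_induct)
    case definable
    show ?case by (intro dfn H_dfn)
  next
    case emp
    have "H emp = emp" by (simp add: emp_iff H)
    then show ?case by simp
  next
    case (suc n)
    have "H (suc n) = cup (H n) (diff Y (f \<cdot> n))" by (auto simp: ext_iff[of "H (suc n)"] H)
    then show ?case using suc fn fin_cup by simp
  qed
  define S where "S = sep (pow X) fin"
  have "definable (\<lambda>e. fin (e 0))" by (intro dfn)
  then have S: "F \<epsilon> S \<longleftrightarrow> F \<sqsubseteq> X \<and> fin F" for F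
    by (simp add: S_def mem_sep)
  have "dedekind_inf S"
  proof (rule dedekind_inf_chain)
    fix n assume n: "n \<epsilon> om"
    have "i \<epsilon> om" if "i \<epsilon> n" for i using om_transitive[OF n that] by simp
    then have "H n \<sqsubseteq> X" using fn by (auto simp: sub_def H YX)
    then show "H n \<epsilon> S" using H_fin[OF n] by (simp add: S)
  next
    show "tdef (\<lambda>e. H (e 0))" by (rule H_dfn)
  next
    fix m n assume "n \<epsilon> om" "m \<epsilon> n"
    then show "H m \<sqsubseteq> H n" using om_transitive[of n m] by (auto simp: sub_def H)
  next
    fix m assume m: "m \<epsilon> om"
    show "\<exists>n. n \<epsilon> om \<and> \<not> H n \<sqsubseteq> H m"
    proof (rule ccontr)
      assume no: "\<not> ?thesis"
      \<comment> \<open>If \<open>H m\<close> contained all partial unions, it would contain the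
        whole infinite complement of \<open>G\<close>.\<close>
      have "diff Y G \<sqsubseteq> H m"
        unfolding sub_def
      proof (intro allI impI)
        fix z assume "z \<epsilon> diff Y G"
        then obtain n where n: "n \<epsilon> om" "z \<epsilon> Y" "\<not> z \<epsilon> f \<cdot> n" by (auto simp: G)
        \<comment> \<open>The complement with index \<open>n\<close> enters at
          \<open>suc n\<close>.\<close>
        then have "z \<epsilon> H (suc n)" by (auto simp: H)
        then show "z \<epsilon> H m" using no suc_om[OF n(1)] unfolding sub_def by blast
      qed
      then show False using H_fin[OF m] inf fin_sub by blast
    qed
  next
    show "H emp = emp" by (simp add: emp_iff H)
  qed
  then show ?thesis using S by (auto simp: quasi_dedekind_inf_def)
qed

section \<open>Evaluation of the formulas in the theorem\<close>

lemma lsat_dedekind_infinite [simp]: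
  "X < d \<Longrightarrow> lsat UNIV E e d r (dedekind_infinite X) \<longleftrightarrow> dedekind_inf (r X)"
  by (simp add: dedekind_infinite_def dedekind_inf_def)

lemma lsat_quasi_dedekind_infinite [simp]:
  "X < d \<Longrightarrow> lsat UNIV E e d r (quasi_dedekind_infinite X) \<longleftrightarrow> quasi_dedekind_inf (r X)"
  by (simp add: quasi_dedekind_infinite_def is_finite_subsets_def quasi_dedekind_inf_def)

lemma lsat_is_topology [simp]:
  "X < d \<Longrightarrow> T < d \<Longrightarrow> lsat UNIV E e d r (is_topology X T) \<longleftrightarrow> topology (r X) (r T)"
  by (simp add: is_topology_def topology_def)

text \<open>The form that matches the formula \<open>is_Gdelta\<close>, which speaks of pairs in
  \<open>f\<close> instead of application.\<close>

lemma Gdelta_maps: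
  "Gdelta G X T \<longleftrightarrow> (\<exists>f. is_map f om T \<and>
     (\<forall>z. z \<epsilon> G \<longleftrightarrow> z \<epsilon> X \<and> (\<forall>n U. pr n U \<epsilon> f \<longrightarrow> z \<epsilon> U)))"
  unfolding Gdelta_def by (intro ex_cong1 conj_cong refl) (simp add: is_map_mem)

lemma lsat_is_Gdelta [simp]:
  "G < d \<Longrightarrow> X < d \<Longrightarrow> T < d \<Longrightarrow>
    lsat UNIV E e d r (is_Gdelta G X T) \<longleftrightarrow> Gdelta (r G) (r X) (r T)"
  by (simp add: is_Gdelta_def Gdelta_maps)

lemma lsat_is_P_space [simp]:
  "X < d \<Longrightarrow> T < d \<Longrightarrow> lsat UNIV E e d r (is_P_space X T) \<longleftrightarrow> P_space (r X) (r T)"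
  by (simp add: is_P_space_def P_space_def)

lemma lsat_is_cofinite_topology [simp]:
  "X < d \<Longrightarrow> T < d \<Longrightarrow>
    lsat UNIV E e d r (is_cofinite_topology X T) \<longleftrightarrow> cofinite_top (r X) (r T)"
  by (simp add: is_cofinite_topology_def cofinite_top_def)

lemma lsat_is_infty_space [simp]:
  "Y < d \<Longrightarrow> T < d \<Longrightarrow> X < d \<Longrightarrow> p < d \<Longrightarrow>
    lsat UNIV E e d r (is_infty_space Y T X p) \<longleftrightarrow> infty_space (r Y) (r T) (r X) (r p)"
  by (simp add: is_infty_space_def infty_space_def)

lemma sat_equivalences:
  "sat UNIV E e\<^sub>0 (((IQDI \<^bold>\<longleftrightarrow> cofinite_not_P) \<^bold>\<and> (cofinite_not_P \<^bold>\<longleftrightarrow> infty_not_P)) 0)"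
proof -
  let ?i = "\<forall>X. \<not> fin X \<longrightarrow> quasi_dedekind_inf X"
  let ?ii = "\<forall>X. \<not> fin X \<longrightarrow> (\<exists>T. cofinite_top X T \<and> \<not> P_space X T)"
  let ?iii = "\<forall>X. \<not> fin X \<longrightarrow> (\<forall>p. \<not> p \<epsilon> X \<longrightarrow> (\<exists>Y T. infty_space Y T X p \<and> \<not> P_space Y T))"
  have "?i \<Longrightarrow> ?ii" using cofinite_not_P_space by blast
  moreover have "?ii \<Longrightarrow> ?iii" using infty_space_not_P_space by blast
  \<comment> \<open>\<open>X\<close> itself serves as the point at infinity, as it is not a member
    of itself.\<close>
  moreover have "?iii \<Longrightarrow> ?i" using quasi_dedekind_inf_infty_space mem_irrefl by metis
  ultimately have "(?i \<longleftrightarrow> ?ii) \<and> (?ii \<longleftrightarrow> ?iii)" by argo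
  then show ?thesis
    unfolding lsat_0[of UNIV E e\<^sub>0 e\<^sub>0, symmetric] lsat_conj lsat_iff
    by (simp add: IQDI_def cofinite_not_P_def infty_not_P_def)
qed

end

theorem corollary4p8:
  shows "ZF \<turnstile> ((IQDI \<^bold>\<longleftrightarrow> cofinite_not_P) \<^bold>\<and> (cofinite_not_P \<^bold>\<longleftrightarrow> infty_not_P)) 0"
  by (rule ZF_completeness, rule ZF_model.sat_equivalences) (simp add: ZF_model_def)

end
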